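(* Let $p,q\ge0$ with $p+q>0$. Then the family $\{C_{p,q}(t), t\in\mathbb R\}$ of operators in $L^1(\mathbb R)$ (defined in the context) is a strongly continuous cosine family and its generator is $\Delta_{p,q}$ (defined in the context).
   Context: For $t\ge0$ and $\phi\in L^1(\mathbb R)$, $$C_{p,q}(t)\phi(x)=\begin{cases}\frac12(\phi(x+t)+\phi(x-t)), & |x|>t,\\[2pt] \frac12(\phi(x+t)+\phi(x-t))+\dfrac{q-p}{2(p+q)}[\phi(-x-t)+\phi(x+t)], & x\in(-t,0),\\[6pt] \frac12(\phi(x+t)+\phi(x-t))+\dfrac{p-q}{2(p+q)}[\phi(t-x)+\phi(x-t)], & x\in(0,t),\end{cases}$$ and $C_{p,q}(-t)=C_{p,q}(t)$. Operator $\Delta_{p,q}$ in $L^1(\mathbb R)$: its domain consists of $\phi\in L^1(\mathbb R)$ of the form $$\phi(x)=qC+Dx-\int_x^0(x-y)\psi(y)\,dy\ \ (x<0),\qquad \phi(x)=pC+Dx+\int_0^x(x-y)\psi(y)\,dy\ \ (x>0),$$ where $C,D$ are real constants and $\psi\in L^1(\mathbb R)$; for such $\phi$, $\Delta_{p,q}\phi=\psi=\phi''$. (Equivalently, $\phi$ is continuously differentiable on each open half-line with $\phi'$ absolutely continuous and $\phi''$ integrable, and $p\phi(0-)=q\phi(0+)$, $\phi'(0+)=\phi'(0-)$.) A strongly continuous cosine family in a Banach space is a strongly continuous family $\{C(t),t\in\mathbb R\}$ of bounded linear operators with $C(0)=I$ and $2C(t)C(s)=C(t+s)+C(t-s)$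 for all $s,t\in\mathbb R$; a bounded one has generator $\Delta$ iff $\lambda(\lambda^2-\Delta)^{-1}=\int_0^\infty e^{-\lambda t}C(t)\,dt$ (strongly) for all $\lambda>0$. *)

theory Defs
  imports "HOL-Analysis.Analysis"
begin

section \<open>The Banach space of (classes of) Lebesgue integrable functions on the real line\<close>

text \<open>
  The elements are classes of \<^term>\<open>lborel\<close>-integrable functions modulo equality almost everywhere.
  As every Lebesgue integrable function agrees almost everywhere with a Borel function, working
  with \<^term>\<open>lborel\<close> instead of \<^term>\<open>lebesgue\<close> yields the same space.
\<close>

definition L1_rel :: "(real \<Rightarrow> real) \<Rightarrow> (real \<Rightarrow> real) \<Rightarrow> bool" where
  "L1_rel f g \<longleftrightarrow> integrable lborel f \<and> integrable lborel g \<and> (AE x in lborel. f x = g x)"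

lemma L1_rel_refl: "integrable lborel f \<Longrightarrow> L1_rel f f"
  by (simp add: L1_rel_def)

lemma part_equivp_L1_rel: "part_equivp L1_rel"
proof (rule part_equivpI)
  show "\<exists>f. L1_rel f f"
    by (rule exI[of _ "\<lambda>_. 0"]) (simp add: L1_rel_def)
  show "symp L1_rel"
    by (rule sympI) (auto simp: L1_rel_def)
  show "transp L1_rel"
    by (rule transpI) (auto simp: L1_rel_def elim: eventually_elim2)
qed

quotient_type L1 = "real \<Rightarrow> real" / partial: L1_rel
  by (rule part_equivp_L1_rel)

lemma integrable_rep_L1: "integrable lborel (rep_L1 \<phi>)"
  using Quotient_rep_reflp[OF Quotient_L1, of \<phi>] by (simp add: L1_rel_def)

lemma abs_L1_eq_iff:
  assumes "integrable lborel f" "integrable lborel g"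
  shows "abs_L1 f = abs_L1 g \<longleftrightarrow> (AE x in lborel. f x = g x)"
  using Quotient_rel[OF Quotient_L1, of f g] assms by (simp add: L1_rel_def)

lemma abs_rep_L1 [simp]: "abs_L1 (rep_L1 \<phi>) = \<phi>"
  by (rule Quotient_abs_rep[OF Quotient_L1])

lemma rep_abs_L1: "integrable lborel f \<Longrightarrow> AE x in lborel. rep_L1 (abs_L1 f) x = f x"
  using abs_L1_eq_iff[of "rep_L1 (abs_L1 f)" f] integrable_rep_L1 by simp

instantiation L1 :: real_vector
begin

lift_definition zero_L1 :: L1 is "\<lambda>_. 0"
  by (simp add: L1_rel_def)

lift_definition plus_L1 :: "L1 \<Rightarrow> L1 \<Rightarrow> L1" is "\<lambda>f g x. f x + g x"
  by (auto simp: L1_rel_def)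

lift_definition minus_L1 :: "L1 \<Rightarrow> L1 \<Rightarrow> L1" is "\<lambda>f g x. f x - g x"
  by (auto simp: L1_rel_def)

lift_definition uminus_L1 :: "L1 \<Rightarrow> L1" is "\<lambda>f x. - f x"
  by (auto simp: L1_rel_def)

lift_definition scaleR_L1 :: "real \<Rightarrow> L1 \<Rightarrow> L1" is "\<lambda>c f x. c * f x"
  by (auto simp: L1_rel_def)

instance
  by standard (transfer, simp add: L1_rel_def algebra_simps)+

end

instantiation L1 :: real_normed_vector
begin

lift_definition norm_L1 :: "L1 \<Rightarrow> real" is "\<lambda>f. \<integral>x. \<bar>f x\<bar> \<partial>lborel"
  by (auto simp: L1_rel_def intro!: integral_cong_AE)

definition dist_L1 :: "L1 \<Rightarrow> L1 \<Rightarrow> real" where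
  "dist_L1 \<phi> \<psi> = norm (\<phi> - \<psi>)"

definition sgn_L1 :: "L1 \<Rightarrow> L1" where
  "sgn_L1 \<phi> = \<phi> /\<^sub>R norm \<phi>"

definition uniformity_L1 :: "(L1 \<times> L1) filter" where
  "uniformity_L1 = (INF e\<in>{0<..}. principal {(\<phi>, \<psi>). dist \<phi> \<psi> < e})"

definition open_L1 :: "L1 set \<Rightarrow> bool" where
  "open_L1 U \<longleftrightarrow> (\<forall>\<phi>\<in>U. eventually (\<lambda>(\<phi>', \<psi>). \<phi>' = \<phi> \<longrightarrow> \<psi> \<in> U) uniformity)"

instance
proof
  fix \<phi> \<psi> :: L1 and c :: real
  show "norm \<phi> = 0 \<longleftrightarrow> \<phi> = 0"
    by transfer (auto simp: L1_rel_def integral_nonneg_eq_0_iff_AE)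
  show "norm (\<phi> + \<psi>) \<le> norm \<phi> + norm \<psi>"
  proof transfer
    fix f g :: "real \<Rightarrow> real" assume "L1_rel f f" "L1_rel g g"
    then have "integrable lborel f" "integrable lborel g" by (auto simp: L1_rel_def)
    then have "(\<integral>x. \<bar>f x + g x\<bar> \<partial>lborel) \<le> (\<integral>x. \<bar>f x\<bar> + \<bar>g x\<bar> \<partial>lborel)"
      by (intro integral_mono) auto
    then show "(\<integral>x. \<bar>f x + g x\<bar> \<partial>lborel) \<le> (\<integral>x. \<bar>f x\<bar> \<partial>lborel) + (\<integral>x. \<bar>g x\<bar> \<partial>lborel)"
      using \<open>integrable lborel f\<close> \<open>integrable lborel g\<close> by simp
  qed
  show "norm (c *\<^sub>R \<phi>) = \<bar>c\<bar> * norm \<phi>"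
    by transfer (simp add: abs_mult)
qed (simp_all add: dist_L1_def sgn_L1_def uniformity_L1_def open_L1_def)

end

lemma norm_abs_L1: "integrable lborel f \<Longrightarrow> norm (abs_L1 f) = (\<integral>x. \<bar>f x\<bar> \<partial>lborel)"
  by (simp add: L1_rel_refl norm_L1.abs_eq)

lemma norm_L1_eq: "norm \<phi> = (\<integral>x. \<bar>rep_L1 \<phi> x\<bar> \<partial>lborel)"
  by (metis abs_rep_L1 integrable_rep_L1 norm_abs_L1)

lemma L1_summable:
  fixes u :: "nat \<Rightarrow> L1"
  assumes "summable (\<lambda>i. norm (u i))"
  shows "summable u"
proof -
  define f where "f i = rep_L1 (u i)" for i
  have f [measurable]: "integrable lborel (f i)" for i
    by (simp add: f_def integrable_rep_L1)
  have f_meas [measurable]: "f i \<in> borel_measurable lborel" for i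
    using f by (rule borel_measurable_integrable)
  have sn: "summable (\<lambda>i. \<integral>x. \<bar>f i x\<bar> \<partial>lborel)"
    using assms by (simp add: norm_L1_eq f_def)
  have nni: "(\<integral>\<^sup>+x. ennreal \<bar>f i x\<bar> \<partial>lborel) = ennreal (\<integral>x. \<bar>f i x\<bar> \<partial>lborel)" for i
    using f by (intro nn_integral_eq_integral) auto
  have "(\<integral>\<^sup>+x. (\<Sum>i. ennreal \<bar>f i x\<bar>) \<partial>lborel) = (\<Sum>i. ennreal (\<integral>x. \<bar>f i x\<bar> \<partial>lborel))"
    by (subst nn_integral_suminf) (auto simp: nni)
  also have "\<dots> \<noteq> \<infinity>"
    using sn by (simp add: ennreal_suminf_neq_top)
  finally have "AE x in lborel. (\<Sum>i. ennreal \<bar>f i x\<bar>) \<noteq> \<infinity>"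
    by (intro nn_integral_PInf_AE) auto
  then have sAE: "AE x in lborel. summable (\<lambda>i. norm (f i x))"
    by eventually_elim (auto intro!: summable_suminf_not_top)
  have tail: "summable (\<lambda>i. \<integral>x. norm (f (i + n) x) \<partial>lborel)" for n
    using sn by (simp add: summable_iff_shift[of "\<lambda>i. \<integral>x. \<bar>f i x\<bar> \<partial>lborel"])
  have tAE: "AE x in lborel. summable (\<lambda>i. norm (f (i + n) x))" for n
    using sAE by eventually_elim (simp add: summable_iff_shift[of "\<lambda>i. \<bar>f i _\<bar>"])
  have tint: "integrable lborel (\<lambda>x. \<Sum>i. f (i + n) x)"
    and tbound: "(\<integral>x. \<bar>\<Sum>i. f (i + n) x\<bar> \<partial>lborel) \<le> (\<Sum>i. \<integral>x. \<bar>f (i + n) x\<bar> \<partial>lborel)" for n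
  proof -
    show I: "integrable lborel (\<lambda>x. \<Sum>i. f (i + n) x)"
      by (rule integrable_suminf[OF f tAE tail])
    have tail': "summable (\<lambda>i. \<integral>x. norm \<bar>f (i + n) x\<bar> \<partial>lborel)"
      using tail[of n] by simp
    have tAE': "AE x in lborel. summable (\<lambda>i. norm \<bar>f (i + n) x\<bar>)"
      using tAE[of n] by simp
    have J: "integrable lborel (\<lambda>x. \<Sum>i. \<bar>f (i + n) x\<bar>)"
      using f by (intro integrable_suminf[OF _ tAE' tail']) auto
    have "(\<integral>x. \<bar>\<Sum>i. f (i + n) x\<bar> \<partial>lborel) \<le> (\<integral>x. (\<Sum>i. \<bar>f (i + n) x\<bar>) \<partial>lborel)"
    proof (rule integral_mono_AE)
      show "AE x in lborel. \<bar>\<Sum>i. f (i + n) x\<bar> \<le> (\<Sum>i. \<bar>f (i + n) x\<bar>)"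
        using tAE[of n] by eventually_elim (auto dest: summable_rabs)
    qed (use I J in auto)
    also have "\<dots> = (\<Sum>i. \<integral>x. \<bar>f (i + n) x\<bar> \<partial>lborel)"
      using f by (intro integral_suminf[OF _ tAE' tail']) auto
    finally show "(\<integral>x. \<bar>\<Sum>i. f (i + n) x\<bar> \<partial>lborel) \<le> (\<Sum>i. \<integral>x. \<bar>f (i + n) x\<bar> \<partial>lborel)" .
  qed
  define S where "S = (\<lambda>x. \<Sum>i. f i x)"
  have S [measurable]: "integrable lborel S"
    using tint[of 0] by (simp add: S_def)
  have psum: "(\<Sum>i<n. u i) = abs_L1 (\<lambda>x. \<Sum>i<n. f i x)" for n
  proof (induction n)
    case 0
    show ?case by (simp add: zero_L1_def)
  next
    case (Suc n)
    have "abs_L1 (\<lambda>x. \<Sum>i<n. f i x) + abs_L1 (f n) = abs_L1 (\<lambda>x. (\<Sum>i<n. f i x) + f n x)"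
      using f by (intro plus_L1.abs_eq L1_rel_refl) auto
    moreover have "u n = abs_L1 (f n)" by (simp add: f_def)
    ultimately show ?case using Suc by simp
  qed
  have bd: "norm ((\<Sum>i<n. u i) - abs_L1 S) \<le> (\<Sum>i. \<integral>x. \<bar>f (i + n) x\<bar> \<partial>lborel)" for n
  proof -
    have "(\<Sum>i<n. u i) - abs_L1 S = abs_L1 (\<lambda>x. (\<Sum>i<n. f i x) - S x)"
      unfolding psum using f S by (intro minus_L1.abs_eq L1_rel_refl) auto
    then have "norm ((\<Sum>i<n. u i) - abs_L1 S) = (\<integral>x. \<bar>(\<Sum>i<n. f i x) - S x\<bar> \<partial>lborel)"
      using f S by (simp add: norm_abs_L1)
    also have "\<dots> = (\<integral>x. \<bar>\<Sum>i. f (i + n) x\<bar> \<partial>lborel)"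
    proof (rule integral_cong_AE)
      show "AE x in lborel. \<bar>(\<Sum>i<n. f i x) - S x\<bar> = \<bar>\<Sum>i. f (i + n) x\<bar>"
        using sAE
      proof eventually_elim
        case (elim x)
        then have "S x = (\<Sum>i. f (i + n) x) + (\<Sum>i<n. f i x)"
          unfolding S_def by (rule suminf_split_initial_segment[OF summable_norm_cancel])
        then show ?case by simp
      qed
    qed (use f S tint[of n] in auto)
    also note tbound
    finally show ?thesis .
  qed
  have "(\<lambda>n. \<Sum>i. \<integral>x. \<bar>f (i + n) x\<bar> \<partial>lborel) \<longlonglongrightarrow> 0"
    by (rule suminf_exist_split2[OF sn])
  then have "(\<lambda>n. (\<Sum>i<n. u i) - abs_L1 S) \<longlonglongrightarrow> 0"
    by (rule Lim_null_comparison[OF always_eventually, rotated]) (use bd in auto)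
  then have "u sums abs_L1 S"
    by (simp add: sums_def LIM_zero_iff)
  then show ?thesis by (rule sums_summable)
qed

instance L1 :: banach
proof
  fix X :: "nat \<Rightarrow> L1" assume X: "Cauchy X"
  have "\<exists>N. \<forall>m\<ge>N. \<forall>n\<ge>N. dist (X m) (X n) < (1/2) ^ k" for k :: nat
    using metric_CauchyD[OF X, of "(1/2) ^ k"] by auto
  then obtain N where N: "\<And>k m n. m \<ge> N k \<Longrightarrow> n \<ge> N k \<Longrightarrow> dist (X m) (X n) < (1/2) ^ k"
    by metis
  define r where "r k = k + (\<Sum>i\<le>k. N i)" for k
  have r_mono: "strict_mono r"
    by (rule strict_monoI_Suc) (simp add: r_def)
  have rN: "r k \<ge> N k" for k
    unfolding r_def by (cases k) auto
  have "norm (X (r (Suc k)) - X (r k)) \<le> (1/2) ^ k" for k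
  proof -
    have "r (Suc k) \<ge> N k"
      using rN[of k] strict_monoD[OF r_mono, of k "Suc k"] by simp
    then show ?thesis
      using N[of k "r (Suc k)" "r k"] rN[of k] by (simp add: dist_norm)
  qed
  then have "summable (\<lambda>k. norm (X (r (Suc k)) - X (r k)))"
    by (intro summable_comparison_test'[OF summable_geometric[of "1/2::real"], of 0]) auto
  then have "summable (\<lambda>k. X (r (Suc k)) - X (r k))"
    by (rule L1_summable)
  then have "(\<lambda>n. \<Sum>k<n. X (r (Suc k)) - X (r k)) \<longlonglongrightarrow> (\<Sum>k. X (r (Suc k)) - X (r k))"
    by (rule summable_LIMSEQ)
  then have "(\<lambda>n. X (r n) - X (r 0)) \<longlonglongrightarrow> (\<Sum>k. X (r (Suc k)) - X (r k))"
    by (simp only: sum_lessThan_telescope[of "\<lambda>k. X (r k)"])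
  then have "(\<lambda>n. X (r n) - X (r 0) + X (r 0)) \<longlonglongrightarrow> (\<Sum>k. X (r (Suc k)) - X (r k)) + X (r 0)"
    by (intro tendsto_add tendsto_const)
  then have lim: "(X \<circ> r) \<longlonglongrightarrow> (\<Sum>k. X (r (Suc k)) - X (r k)) + X (r 0)"
    by (simp add: o_def)
  show "convergent X"
    using Cauchy_converges_subseq[OF X r_mono lim] by (auto simp: convergent_def)
qed


section \<open>Cosine families and generators\<close>

definition strongly_continuous_cosine_family :: "(real \<Rightarrow> 'a::banach \<Rightarrow> 'a) \<Rightarrow> bool" where
  "strongly_continuous_cosine_family C \<longleftrightarrow>
     (\<forall>t. bounded_linear (C t)) \<and>
     (\<forall>x. continuous_on UNIV (\<lambda>t. C t x)) \<and>
     (\<forall>x. C 0 x = x) \<and>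
     (\<forall>s t x. 2 *\<^sub>R C t (C s x) = C (t + s) x + C (t - s) x)"

definition bounded_cosine_family :: "(real \<Rightarrow> 'a::banach \<Rightarrow> 'a) \<Rightarrow> bool" where
  "bounded_cosine_family C \<longleftrightarrow>
     strongly_continuous_cosine_family C \<and> (\<exists>M. \<forall>t x. norm (C t x) \<le> M * norm x)"

text \<open>
  An unbounded operator is given by its domain \<open>D\<close> and a function \<open>A\<close>, whose values outside \<open>D\<close>
  are irrelevant. The function \<open>\<lambda>x. \<mu> x - A x\<close> on \<open>D\<close> is required to be a bijection onto the whole
  space with bounded linear inverse; in particular \<open>D\<close> is then a linear subspace on which \<open>A\<close>
  is linear.
\<close>

definition resolvent :: "'a::banach set \<Rightarrow> ('a \<Rightarrow> 'a) \<Rightarrow> real \<Rightarrow> 'a \<Rightarrow> 'a" where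
  "resolvent D A \<mu> = inv_into D (\<lambda>x. \<mu> *\<^sub>R x - A x)"

definition in_resolvent_set :: "'a::banach set \<Rightarrow> ('a \<Rightarrow> 'a) \<Rightarrow> real \<Rightarrow> bool" where
  "in_resolvent_set D A \<mu> \<longleftrightarrow>
     bij_betw (\<lambda>x. \<mu> *\<^sub>R x - A x) D UNIV \<and> bounded_linear (resolvent D A \<mu>)"

text \<open>
  The characterization of the generator by the Laplace transform is meaningful for bounded cosine
  families only, which is why boundedness is part of the definition. The integrand is
  continuous with exponentially decaying norm, so the vector-valued integral over the half-line is
  an improper Riemann integral, hence covered by the gauge integral.
\<close>

definition is_cosine_generator ::
    "(real \<Rightarrow> 'a::banach \<Rightarrow> 'a) \<Rightarrow> 'a set \<Rightarrow> ('a \<Rightarrow> 'a) \<Rightarrow> bool" where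
  "is_cosine_generator C D A \<longleftrightarrow>
     bounded_cosine_family C \<and>
     (\<forall>\<mu>>0. in_resolvent_set D A (\<mu>\<^sup>2) \<and>
       (\<forall>x. ((\<lambda>t. exp (- \<mu> * t) *\<^sub>R C t x) has_integral \<mu> *\<^sub>R resolvent D A (\<mu>\<^sup>2) x) {0..}))"


section \<open>The family \<open>C\<^sub>p\<^sub>,\<^sub>q\<close>\<close>

text \<open>
  The absolute value of \<open>t\<close> implements \<open>C\<^sub>p\<^sub>,\<^sub>q(-t) = C\<^sub>p\<^sub>,\<^sub>q(t)\<close>. The values at the (at most three)
  points \<open>x = 0\<close> and \<open>\<bar>x\<bar> = \<bar>t\<bar>\<close> are immaterial.
\<close>

definition Cpq_fun :: "real \<Rightarrow> real \<Rightarrow> real \<Rightarrow> (real \<Rightarrow> real) \<Rightarrow> real \<Rightarrow> real" where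
  "Cpq_fun p q t f = (let s = \<bar>t\<bar> in (\<lambda>x.
     if - s < x \<and> x < 0 then
       (f (x + s) + f (x - s)) / 2 + (q - p) / (2 * (p + q)) * (f (- x - s) + f (x + s))
     else if 0 < x \<and> x < s then
       (f (x + s) + f (x - s)) / 2 + (p - q) / (2 * (p + q)) * (f (s - x) + f (x - s))
     else (f (x + s) + f (x - s)) / 2))"

lemma AE_lborel_affine:
  fixes c t :: real
  assumes "AE x in lborel. P x" "c \<noteq> 0"
  shows "AE x in lborel. P (t + c * x)"
proof -
  have "AE x in density (distr lborel borel (\<lambda>x. t + c * x)) (\<lambda>_. ennreal \<bar>c\<bar>). P x"
    by (subst lborel_real_affine[OF \<open>c \<noteq> 0\<close>, of t, symmetric]) (rule assms(1))
  then have "AE x in distr lborel borel (\<lambda>x. t + c * x). P x"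
    using \<open>c \<noteq> 0\<close> by (subst (asm) AE_density) auto
  then show ?thesis
    by (rule AE_distrD[rotated]) simp
qed

lemma Cpq_fun_integrable:
  assumes f: "integrable lborel f"
  shows "integrable lborel (Cpq_fun p q t f)"
proof -
  define s where "s = \<bar>t\<bar>"
  have plus: "integrable lborel (\<lambda>x. f (x + c))" for c
    using lborel_integrable_real_affine[OF f, of 1 c] by (simp add: add.commute)
  have minus: "integrable lborel (\<lambda>x. f (c - x))" for c
    using lborel_integrable_real_affine[OF f, of "-1" c] by simp
  have a: "integrable lborel (\<lambda>x. f (x + s))" using plus .
  have b: "integrable lborel (\<lambda>x. f (x - s))" using plus[of "- s"] by simp
  have c: "integrable lborel (\<lambda>x. f (s - x))" using minus .
  have d: "integrable lborel (\<lambda>x. f (- x - s))"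
    using minus[of "- s"] by (simp only: minus_diff_commute)
  have "integrable lborel (\<lambda>x. (f (x + s) + f (x - s)) / 2
      + indicator {-s<..<0} x *\<^sub>R ((q - p) / (2 * (p + q)) * (f (- x - s) + f (x + s)))
      + indicator {0<..<s} x *\<^sub>R ((p - q) / (2 * (p + q)) * (f (s - x) + f (x - s))))"
    by (intro Bochner_Integration.integrable_add integrable_mult_indicator integrable_mult_right
        integrable_divide a b c d) auto
  also have "(\<lambda>x. (f (x + s) + f (x - s)) / 2
      + indicator {-s<..<0} x *\<^sub>R ((q - p) / (2 * (p + q)) * (f (- x - s) + f (x + s)))
      + indicator {0<..<s} x *\<^sub>R ((p - q) / (2 * (p + q)) * (f (s - x) + f (x - s))))
      = Cpq_fun p q t f"
    by (auto simp: Cpq_fun_def Let_def s_def[symmetric] indicator_def fun_eq_iff)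
  finally show ?thesis .
qed

lift_definition Cpq :: "real \<Rightarrow> real \<Rightarrow> real \<Rightarrow> L1 \<Rightarrow> L1" is Cpq_fun
proof -
  fix p q t :: real and f g :: "real \<Rightarrow> real"
  assume "L1_rel f g"
  then have f: "integrable lborel f" and g: "integrable lborel g"
    and eq: "AE x in lborel. f x = g x"
    by (auto simp: L1_rel_def)
  define s where "s = \<bar>t\<bar>"
  have plus: "AE x in lborel. f (x + c) = g (x + c)" for c
    using AE_lborel_affine[OF eq, of 1 c] by (simp add: add.commute)
  have minus: "AE x in lborel. f (c - x) = g (c - x)" for c
    using AE_lborel_affine[OF eq, of "-1" c] by simp
  have "AE x in lborel. Cpq_fun p q t f x = Cpq_fun p q t g x"
    using plus[of s] plus[of "- s"] minus[of s] minus[of "- s"]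
    by eventually_elim (simp add: Cpq_fun_def Let_def s_def[symmetric] minus_diff_commute[of _ s])
  then show "L1_rel (Cpq_fun p q t f) (Cpq_fun p q t g)"
    using f g by (simp add: L1_rel_def Cpq_fun_integrable)
qed


section \<open>The operator \<open>\<Delta>\<^sub>p\<^sub>,\<^sub>q\<close>\<close>

definition Delta_rel_fun :: "real \<Rightarrow> real \<Rightarrow> (real \<Rightarrow> real) \<Rightarrow> (real \<Rightarrow> real) \<Rightarrow> bool" where
  "Delta_rel_fun p q f g \<longleftrightarrow> (\<exists>C D. AE x in lborel.
     (x < 0 \<longrightarrow> f x = q * C + D * x - (LBINT y:{x..0}. (x - y) * g y)) \<and>
     (x > 0 \<longrightarrow> f x = p * C + D * x + (LBINT y:{0..x}. (x - y) * g y)))"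

lift_definition Delta_rel :: "real \<Rightarrow> real \<Rightarrow> L1 \<Rightarrow> L1 \<Rightarrow> bool" is Delta_rel_fun
proof -
  fix p q :: real and f f' g g' :: "real \<Rightarrow> real"
  assume "L1_rel f f'" "L1_rel g g'"
  then have f: "AE x in lborel. f x = f' x" and g: "AE y in lborel. g y = g' y"
    and [measurable]: "g \<in> borel_measurable lborel" "g' \<in> borel_measurable lborel"
    by (auto simp: L1_rel_def)
  have int: "(LBINT y:{a..b}. (x - y) * g y) = (LBINT y:{a..b}. (x - y) * g' y)" for a b x
    unfolding set_lebesgue_integral_def
    by (rule integral_cong_AE) (use g in auto)
  have "(AE x in lborel. P x (f x)) \<longleftrightarrow> (AE x in lborel. P x (f' x))" for P
    using f by (intro eventually_subst) (auto elim: eventually_mono)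
  from this[of "\<lambda>x y. (x < 0 \<longrightarrow> y = q * _ + _ * x - (LBINT z:{x..0}. (x - z) * g' z)) \<and>
      (x > 0 \<longrightarrow> y = p * _ + _ * x + (LBINT z:{0..x}. (x - z) * g' z))"]
  show "Delta_rel_fun p q f g = Delta_rel_fun p q f' g'"
    unfolding Delta_rel_fun_def int by simp
qed

definition Delta_dom :: "real \<Rightarrow> real \<Rightarrow> L1 set" where
  "Delta_dom p q = {\<phi>. \<exists>\<psi>. Delta_rel p q \<phi> \<psi>}"

definition Delta :: "real \<Rightarrow> real \<Rightarrow> L1 \<Rightarrow> L1" where
  "Delta p q \<phi> = (THE \<psi>. Delta_rel p q \<phi> \<psi>)"

end

theory Submission
  imports Defs
begin

text \<open>
  Put \<open>b = (q - p) / (p + q)\<close> and let \<open>J f(x) = sgn x (f(x) + f(-x)) / 2\<close>. Since \<open>J\<close> annihilates odd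
  functions and takes odd values only, \<open>J J = 0\<close>, and \<open>J G J = 0\<close> for every operator \<open>G\<close> that preserves
  parity. A case distinction on the signs of \<open>x\<close> and \<open>x \<plusminus> t\<close> shows that \<open>C\<^sub>p\<^sub>,\<^sub>q(t) = (I - b J) G(t) (I + b J)\<close>,
  where \<open>G(t) f(x) = (f(x + t) + f(x - t)) / 2\<close> is the translation cosine family. So \<open>C\<^sub>p\<^sub>,\<^sub>q\<close> is
  similar to \<open>G\<close>, and the same similarity carries \<open>\<Delta>\<^sub>p\<^sub>,\<^sub>q\<close> to the second derivative without transmission
  condition, which is \<open>\<Delta>\<^sub>1\<^sub>,\<^sub>1\<close>. For \<open>G\<close> the Laplace transform is the convolution with
  \<open>exp (- \<mu> \<bar>v\<bar>) / 2\<close>; its kernel is \<open>\<mu>\<close> times the Green function of \<open>\<mu>\<^sup>2 - d\<^sup>2/dx\<^sup>2\<close>.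
\<close>

section \<open>Laplace transforms and generators of cosine families\<close>

text \<open>The constant \<open>b\<close> is dictated by the transmission condition. On a function
  equal to \<open>q C\<close> on the left half-line and \<open>p C\<close> on the right, J gives sgn
  x (p + q) C / 2, so I + b J turns both values into the mean (p + q) C / 2 for all \<open>C\<close>
  exactly if b (p + q) = q - p. The summand \<open>D x\<close> is odd and annihilated by J, and the
  second antiderivative based at the origin commutes with reflection and with multiplication by the
  sign, hence with J. So the one-sided constants are the only part of the representation that the
  similarity alters. Domains are therefore compared through the integral representation, as a
  relation between a function and its second derivative, and nothing is differentiated across the
  origin. The Laplace integral takes values in \<open>L1\<close>, where point evaluation makes no
  sense. It is shown to exist by a Cauchy criterion and only then identified, by testing it with
  bounded functions.\<close>

lemma has_integral_exp_halfline:
  fixes \<mu> :: real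
  assumes "\<mu> > 0"
  shows "((\<lambda>t. exp (- \<mu> * t)) has_integral 1 / \<mu>) {0..}"
  using has_integral_exp_minus_to_infinity[OF assms, of 0] by simp

text \<open>Continuity settles compact intervals. On the half-line, the integral over
  \<open>{b..d}\<close> is at most \<open>K * (exp (- \<mu> * b) / \<mu>)\<close> uniformly in
  \<open>d\<close>, which is the Cauchy condition for the vector-valued integral.\<close>

lemma laplace_integrable:
  fixes g :: "real \<Rightarrow> 'a::banach"
  assumes \<mu>: "\<mu> > 0" and cont: "continuous_on UNIV g" and bound: "\<And>t. norm (g t) \<le> K"
  shows "(\<lambda>t. exp (- \<mu> * t) *\<^sub>R g t) integrable_on {0..}"
proof -
  define f where "f t = exp (- \<mu> * t) *\<^sub>R g t" for t
  have f_cont: "continuous_on S f" for S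
    unfolding f_def by (intro continuous_intros continuous_on_subset[OF cont]) auto
  have K: "K \<ge> 0"
    using bound[of 0] norm_ge_zero order_trans by blast
  have restrict: "(\<lambda>t. if t \<in> {0..} then f t else 0) integrable_on {a..b}"
    "integral {a..b} (\<lambda>t. if t \<in> {0..} then f t else 0) = integral {0..b} f" if "a \<le> 0" for a b
  proof -
    have "{0..} \<inter> {a..b} = {0..b}" using that by auto
    then show "(\<lambda>t. if t \<in> {0..} then f t else 0) integrable_on {a..b}"
      "integral {a..b} (\<lambda>t. if t \<in> {0..} then f t else 0) = integral {0..b} f"
      unfolding integrable_restrict_Int integral_restrict_Int
      by (simp_all only: integrable_continuous_interval[OF f_cont])
  qed
  have tail: "norm (integral {b..d} f) \<le> K * (exp (- \<mu> * b) / \<mu>)" if "b \<le> d" for b d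
  proof -
    have e: "((\<lambda>t. exp (- \<mu> * t)) has_integral exp (- \<mu> * b) / \<mu>) {b..}"
      by (rule has_integral_exp_minus_to_infinity[OF \<mu>])
    have int: "(\<lambda>t. K * exp (- \<mu> * t)) integrable_on {b..d}"
      by (intro integrable_continuous_interval continuous_intros)
    have "norm (integral {b..d} f) \<le> integral {b..d} (\<lambda>t. K * exp (- \<mu> * t))"
      using bound by (intro integral_norm_bound_integral integrable_continuous_interval[OF f_cont] int)
        (simp add: f_def mult.commute mult_right_mono)
    also have "\<dots> \<le> integral {b..} (\<lambda>t. K * exp (- \<mu> * t))"
      by (rule integral_subset_le[OF _ int has_integral_integrable[OF has_integral_mult_right[OF e]]])
        (simp_all add: K)
    also have "\<dots> = K * (exp (- \<mu> * b) / \<mu>)"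
      using has_integral_mult_right[OF e, of K] by (rule integral_unique)
    finally show ?thesis .
  qed
  have "f integrable_on {0..}"
  proof (rule integrable_alt_subset[THEN iffD2], intro conjI allI impI)
    fix a b :: real
    have "{0..} \<inter> {a..b} = {max 0 a..b}"
      by (rule set_eqI) (simp only: Int_iff atLeast_iff atLeastAtMost_iff max.bounded_iff conj_assoc)
    then show "(\<lambda>t. if t \<in> {0..} then f t else 0) integrable_on cbox a b"
      unfolding integrable_restrict_Int cbox_interval
      by (simp only: integrable_continuous_interval[OF f_cont])
  next
    fix e :: real assume "e > 0"
    have "((\<lambda>b. exp (- \<mu> * b)) \<longlongrightarrow> 0) at_top"
      using \<mu> by (intro filterlim_compose[OF exp_at_bot]
          filterlim_tendsto_neg_mult_at_bot[OF tendsto_const _ filterlim_ident]) simp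
    then have "((\<lambda>b. K * (exp (- \<mu> * b) / \<mu>)) \<longlongrightarrow> K * (0 / \<mu>)) at_top"
      using \<mu> by (intro tendsto_mult_left tendsto_divide tendsto_const) simp_all
    then have "\<forall>\<^sub>F b in at_top. K * (exp (- \<mu> * b) / \<mu>) < e"
      using \<open>e > 0\<close> by (intro order_tendstoD) auto
    then obtain B0 where B0: "\<And>b. b \<ge> B0 \<Longrightarrow> K * (exp (- \<mu> * b) / \<mu>) < e"
      by (auto simp: eventually_at_top_linorder)
    show "\<exists>B>0. \<forall>a b c d. ball 0 B \<subseteq> cbox a b \<and> cbox a b \<subseteq> cbox c d \<longrightarrow>
        norm (integral (cbox a b) (\<lambda>t. if t \<in> {0..} then f t else 0) -
          integral (cbox c d) (\<lambda>t. if t \<in> {0..} then f t else 0)) < e"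
    proof (intro exI[of _ "max 1 B0 + 1"] conjI allI impI)
      fix a b c d :: real
      assume *: "ball 0 (max 1 B0 + 1) \<subseteq> cbox a b \<and> cbox a b \<subseteq> cbox c d"
      have "max 1 B0 \<in> ball 0 (max 1 B0 + 1)" "- max 1 B0 \<in> ball 0 (max 1 B0 + 1)"
        by (auto simp: dist_real_def)
      then have "max 1 B0 \<in> cbox a b" "- max 1 B0 \<in> cbox a b"
        using * by blast+
      then have ab: "a \<le> 0" "b \<ge> B0" "b \<ge> 0" by auto
      then have cd: "c \<le> 0" "b \<le> d" using * by auto
      have "integral {0..b} f + integral {b..d} f = integral {0..d} f"
        using ab cd by (intro Henstock_Kurzweil_Integration.integral_combine
            integrable_continuous_interval[OF f_cont]) auto
      then have "norm (integral {0..b} f - integral {0..d} f) = norm (integral {b..d} f)"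
        by (metis add_diff_cancel_left' norm_minus_commute)
      also have "\<dots> < e"
        using tail[OF cd(2)] B0[OF ab(2)] by simp
      finally show "norm (integral (cbox a b) (\<lambda>t. if t \<in> {0..} then f t else 0) -
          integral (cbox c d) (\<lambda>t. if t \<in> {0..} then f t else 0)) < e"
        using restrict(2)[OF ab(1), of b] restrict(2)[OF cd(1), of d] by simp
    qed simp
  qed
  then show ?thesis by (simp add: f_def[abs_def])
qed

lemma laplace_norm_le:
  fixes g :: "real \<Rightarrow> 'a::banach"
  assumes \<mu>: "\<mu> > 0" and bound: "\<And>t. norm (g t) \<le> K"
    and I: "((\<lambda>t. exp (- \<mu> * t) *\<^sub>R g t) has_integral I) {0..}"
  shows "norm I \<le> K / \<mu>"
proof -
  have e: "((\<lambda>t. K * exp (- \<mu> * t)) has_integral K * (1 / \<mu>)) {0..}"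
    by (intro has_integral_mult_right has_integral_exp_halfline[OF \<mu>])
  have "norm (integral {0..} (\<lambda>t. exp (- \<mu> * t) *\<^sub>R g t)) \<le> integral {0..} (\<lambda>t. K * exp (- \<mu> * t))"
    using I e bound by (intro integral_norm_bound_integral)
      (auto simp: mult.commute mult_right_mono has_integral_integrable)
  then show ?thesis
    using integral_unique[OF I] integral_unique[OF e] by simp
qed

text \<open>Abelian argument: \<open>\<mu>\<close> times the transform tends to \<open>g 0\<close>
  as \<open>\<mu>\<close> grows. It is made quantitative with a single \<open>\<mu>\<close>,
  computed from a radius of continuity of \<open>g\<close> at the origin.\<close>

lemma laplace_abel:
  fixes g :: "real \<Rightarrow> 'a::banach"
  assumes cont: "continuous_on UNIV g" and bound: "\<And>t. norm (g t) \<le> K"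
    and zero: "\<And>\<mu>. \<mu> > 0 \<Longrightarrow> ((\<lambda>t. exp (- \<mu> * t) *\<^sub>R g t) has_integral 0) {0..}"
  shows "g 0 = 0"
proof (rule ccontr)
  assume "g 0 \<noteq> 0"
  define e where "e = norm (g 0) / 2"
  have e: "e > 0" using \<open>g 0 \<noteq> 0\<close> by (simp add: e_def)
  have K: "K \<ge> 0"
    using bound[of 0] norm_ge_zero order_trans by blast
  obtain d where d: "d > 0" "\<And>t. \<bar>t\<bar> < d \<Longrightarrow> norm (g t - g 0) < e"
    using cont e by (auto simp: continuous_on_iff dist_norm) (metis abs_minus_commute diff_0_right)
  \<comment> \<open>The slope makes \<open>b * t\<close> at least the trivial bound
    \<open>2 * K\<close> once \<open>t \<ge> d\<close>, so \<open>e + b * t\<close> bounds the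
    increment of \<open>g\<close> both near the origin and far from it.\<close>
  define b where "b = 2 * K / d"
  have b: "b \<ge> 0" using K d by (simp add: b_def)
  have near: "norm (g t - g 0) \<le> e + b * t" if "t \<ge> 0" for t
  proof (cases "t < d")
    case True
    then show ?thesis using d(2)[of t] that b e by (smt (verit) mult_nonneg_nonneg)
  next
    case False
    have "norm (g t - g 0) \<le> 2 * K"
      using norm_triangle_ineq4[of "g t" "g 0"] bound[of t] bound[of 0] by simp
    also have "\<dots> \<le> b * t"
      using False d(1) K by (simp add: b_def field_simps mult_left_mono)
    finally show ?thesis using e by simp
  qed
  \<comment> \<open>The final estimate is \<open>norm (g 0) \<le> e + 4 * b / \<mu>\<close>, while
    \<open>norm (g 0) = 2 * e\<close>. The summand 1 makes \<open>4 * b / \<mu> < e\<close> strict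
    and keeps \<open>\<mu>\<close> positive when \<open>b = 0\<close>.\<close>
  define \<mu> where "\<mu> = 4 * b / e + 1"
  have \<mu>: "\<mu> > 0" using b e by (simp add: \<mu>_def add_nonneg_pos)
  let ?h = "\<lambda>t. exp (- \<mu> * t) *\<^sub>R (g 0 - g t)"
  have "((\<lambda>t. exp (- \<mu> * t) *\<^sub>R g 0 - exp (- \<mu> * t) *\<^sub>R g t) has_integral (1 / \<mu>) *\<^sub>R g 0 - 0) {0..}"
    by (intro has_integral_diff zero[OF \<mu>] has_integral_scaleR_left has_integral_exp_halfline \<mu>)
  then have h: "(?h has_integral (1 / \<mu>) *\<^sub>R g 0) {0..}"
    by (simp add: scaleR_diff_right)
  have E: "((\<lambda>t. e * exp (- \<mu> * t) + (2 * b / \<mu>) * exp (- (\<mu> / 2) * t)) has_integral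
      e * (1 / \<mu>) + (2 * b / \<mu>) * (1 / (\<mu> / 2))) {0..}"
    using \<mu> by (intro has_integral_add has_integral_mult_right has_integral_exp_halfline) auto
  have "norm (integral {0..} ?h) \<le>
      integral {0..} (\<lambda>t. e * exp (- \<mu> * t) + (2 * b / \<mu>) * exp (- (\<mu> / 2) * t))"
  proof (rule integral_norm_bound_integral)
    fix t :: real assume "t \<in> {0..}"
    then have t: "t \<ge> 0" by simp
    \<comment> \<open>Half of the exponential is spent on absorbing the factor \<open>t\<close>, so
      that only pure exponentials have to be integrated.\<close>
    have "\<mu> / 2 * t \<le> exp (\<mu> / 2 * t)"
      using exp_ge_add_one_self[of "\<mu> / 2 * t"] by linarith
    then have "\<mu> / 2 * t * exp (- \<mu> * t) \<le> exp (\<mu> / 2 * t) * exp (- \<mu> * t)"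
      by (rule mult_right_mono) simp
    also have "\<dots> = exp (- (\<mu> / 2) * t)"
      by (simp flip: exp_add)
    finally have "t * exp (- \<mu> * t) \<le> 2 / \<mu> * exp (- (\<mu> / 2) * t)"
      using \<mu> by (simp add: field_simps)
    then have *: "b * (t * exp (- \<mu> * t)) \<le> b * (2 / \<mu> * exp (- (\<mu> / 2) * t))"
      using b by (rule mult_left_mono)
    have "norm (?h t) \<le> exp (- \<mu> * t) * (e + b * t)"
      using near[OF t] by (simp add: norm_minus_commute)
    also have "\<dots> \<le> e * exp (- \<mu> * t) + (2 * b / \<mu>) * exp (- (\<mu> / 2) * t)"
      using * by (simp add: algebra_simps)
    finally show "norm (?h t) \<le> e * exp (- \<mu> * t) + (2 * b / \<mu>) * exp (- (\<mu> / 2) * t)" .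
  qed (use h E in \<open>auto intro: has_integral_integrable\<close>)
  then have "norm ((1 / \<mu>) *\<^sub>R g 0) \<le> e * (1 / \<mu>) + 2 * b / \<mu> * (1 / (\<mu> / 2))"
    by (simp only: integral_unique[OF h] integral_unique[OF E])
  also have "\<dots> = e / \<mu> + 4 * b / \<mu> / \<mu>"
    by simp
  also have "norm ((1 / \<mu>) *\<^sub>R g 0) = norm (g 0) / \<mu>"
    using \<mu> by simp
  finally have "norm (g 0) / \<mu> \<le> e / \<mu> + 4 * b / \<mu> / \<mu>" .
  then have "norm (g 0) / \<mu> * \<mu> \<le> (e / \<mu> + 4 * b / \<mu> / \<mu>) * \<mu>"
    using \<mu> by (intro mult_right_mono) auto
  then have "norm (g 0) \<le> e + 4 * b / \<mu>"
    using \<mu> by (simp add: algebra_simps)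
  moreover have "4 * b / \<mu> < e"
    using \<mu> e by (simp add: \<mu>_def field_simps)
  ultimately show False by (simp add: e_def)
qed

text \<open>
  Uniqueness of \<open>y\<close> with \<open>L x y\<close> need not be assumed: if \<open>L 0 g\<close>, then adding it to the resolvent
  equation of \<open>g\<close> shows that the Laplace transform of \<open>C t g\<close> vanishes for all \<open>\<mu>\<close>.
\<close>

lemma cosine_generatorI:
  fixes C :: "real \<Rightarrow> 'a::banach \<Rightarrow> 'a" and L :: "'a \<Rightarrow> 'a \<Rightarrow> bool"
  assumes C: "bounded_cosine_family C"
    and add: "\<And>x y x' y'. L x y \<Longrightarrow> L x' y' \<Longrightarrow> L (x + x') (y + y')"
    and scale: "\<And>c x y. L x y \<Longrightarrow> L (c *\<^sub>R x) (c *\<^sub>R y)"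
    and inj: "\<And>\<mu> x. \<mu> > 0 \<Longrightarrow> L x (\<mu>\<^sup>2 *\<^sub>R x) \<Longrightarrow> x = 0"
    and surj: "\<And>\<mu> h. \<mu> > 0 \<Longrightarrow> \<exists>u. L u (\<mu>\<^sup>2 *\<^sub>R u - h) \<and>
      ((\<lambda>t. exp (- \<mu> * t) *\<^sub>R C t h) has_integral \<mu> *\<^sub>R u) {0..}"
  shows "is_cosine_generator C {x. \<exists>y. L x y} (\<lambda>x. THE y. L x y)"
proof -
  from C obtain M where lin: "\<And>t. bounded_linear (C t)"
    and cont: "\<And>x. continuous_on UNIV (\<lambda>t. C t x)" and C0: "\<And>x. C 0 x = x"
    and M: "\<And>t x. norm (C t x) \<le> M * norm x"
    unfolding bounded_cosine_family_def strongly_continuous_cosine_family_def by blast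
  have diff: "L (x - x') (y - y')" if "L x y" "L x' y'" for x x' y y'
    using add[OF that(1) scale[OF that(2), of "-1"]] by simp
  have zero: "g = 0" if g: "L 0 g" for g
  proof -
    have "((\<lambda>t. exp (- \<mu> * t) *\<^sub>R C t g) has_integral 0) {0..}" if \<mu>: "\<mu> > 0" for \<mu>
    proof -
      obtain u where u: "L u (\<mu>\<^sup>2 *\<^sub>R u - g)"
        and i: "((\<lambda>t. exp (- \<mu> * t) *\<^sub>R C t g) has_integral \<mu> *\<^sub>R u) {0..}"
        using surj[OF \<mu>] by blast
      have "L u (\<mu>\<^sup>2 *\<^sub>R u)"
        using add[OF u g] by simp
      then have "u = 0" by (rule inj[OF \<mu>])
      then show ?thesis using i by simp
    qed
    then have "C 0 g = 0"
      by (rule laplace_abel[OF cont M])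
    then show ?thesis by (simp add: C0)
  qed
  have single: "(THE y. L x y) = y" if "L x y" for x y
  proof (rule the_equality)
    fix y' assume "L x y'"
    then have "L 0 (y' - y)" using diff[OF \<open>L x y'\<close> that] by simp
    then show "y' = y" using zero by fastforce
  qed fact
  show ?thesis
    unfolding is_cosine_generator_def
  proof (intro conjI allI impI C)
    fix \<mu> :: real assume \<mu>: "\<mu> > 0"
    define D where "D = {x. \<exists>y. L x y}"
    define A where "A x = (THE y. L x y)" for x
    have A: "L x y \<Longrightarrow> A x = y" for x y
      unfolding A_def by (rule single)
    obtain R where R: "\<And>h. L (R h) (\<mu>\<^sup>2 *\<^sub>R R h - h)"
      and I: "\<And>h. ((\<lambda>t. exp (- \<mu> * t) *\<^sub>R C t h) has_integral \<mu> *\<^sub>R R h) {0..}"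
      using surj[OF \<mu>] by metis
    have inv: "\<mu>\<^sup>2 *\<^sub>R R h - A (R h) = h" for h
      using A[OF R[of h]] by simp
    have RD: "R h \<in> D" for h using R by (auto simp: D_def)
    have inj_D: "inj_on (\<lambda>x. \<mu>\<^sup>2 *\<^sub>R x - A x) D"
    proof (rule inj_onI)
      fix x x' assume "x \<in> D" "x' \<in> D" and eq: "\<mu>\<^sup>2 *\<^sub>R x - A x = \<mu>\<^sup>2 *\<^sub>R x' - A x'"
      then have "L x (A x)" "L x' (A x')" using A by (auto simp: D_def)
      then have "L (x - x') (A x - A x')" by (rule diff)
      also have "A x - A x' = \<mu>\<^sup>2 *\<^sub>R (x - x')"
        using eq by (simp add: algebra_simps)
      finally have "x - x' = 0" by (rule inj[OF \<mu>])
      then show "x = x'" by simp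
    qed
    have bij: "bij_betw (\<lambda>x. \<mu>\<^sup>2 *\<^sub>R x - A x) D UNIV"
      unfolding bij_betw_def
    proof (intro conjI inj_D equalityI subset_UNIV subsetI)
      show "h \<in> (\<lambda>x. \<mu>\<^sup>2 *\<^sub>R x - A x) ` D" for h
        using RD[of h] by (rule rev_image_eqI) (rule inv[symmetric])
    qed
    have res: "resolvent D A (\<mu>\<^sup>2) h = R h" for h
      unfolding resolvent_def using inv_into_f_f[OF inj_D RD, of h] inv[of h] by simp
    \<comment> \<open>\<open>R\<close> was obtained by choice. Its linearity and its bound are read
      off the Laplace integral, whose value determines \<open>\<mu> *\<^sub>R R h\<close>.\<close>
    have "bounded_linear R"
    proof (rule bounded_linear_intro[where K = "M / \<mu> / \<mu>"])
      fix x y :: 'a and c :: real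
      have "((\<lambda>t. exp (- \<mu> * t) *\<^sub>R C t (x + y)) has_integral \<mu> *\<^sub>R R x + \<mu> *\<^sub>R R y) {0..}"
        using has_integral_add[OF I[of x] I[of y]]
        by (simp add: bounded_linear.linear[OF lin, THEN linear_add] scaleR_add_right)
      then show "R (x + y) = R x + R y"
        using has_integral_unique[OF I[of "x + y"]] \<mu> by (force simp flip: scaleR_add_right)
      have "((\<lambda>t. exp (- \<mu> * t) *\<^sub>R C t (c *\<^sub>R x)) has_integral c *\<^sub>R \<mu> *\<^sub>R R x) {0..}"
        using has_integral_cmul[OF I[of x], of c]
        by (simp add: bounded_linear.linear[OF lin, THEN linear_scale] mult.commute)
      then have "\<mu> *\<^sub>R R (c *\<^sub>R x) = \<mu> *\<^sub>R (c *\<^sub>R R x)"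
        using has_integral_unique[OF I[of "c *\<^sub>R x"]] by (force simp: mult.commute)
      then show "R (c *\<^sub>R x) = c *\<^sub>R R x"
        using \<mu> by (metis scaleR_left_imp_eq less_irrefl)
      have "norm (\<mu> *\<^sub>R R x) \<le> M * norm x / \<mu>"
        by (rule laplace_norm_le[OF \<mu> M I])
      then show "norm (R x) \<le> norm x * (M / \<mu> / \<mu>)"
        using \<mu> by (simp add: field_simps)
    qed
    then have "in_resolvent_set D A (\<mu>\<^sup>2)"
      using bij ext[of "resolvent D A (\<mu>\<^sup>2)" R, OF res] by (simp add: in_resolvent_set_def)
    moreover have "((\<lambda>t. exp (- \<mu> * t) *\<^sub>R C t x) has_integral \<mu> *\<^sub>R resolvent D A (\<mu>\<^sup>2) x) {0..}" for x
      using I res by simp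
    ultimately show "in_resolvent_set {x. \<exists>y. L x y} (\<lambda>x. THE y. L x y) (\<mu>\<^sup>2)"
      "\<And>x. ((\<lambda>t. exp (- \<mu> * t) *\<^sub>R C t x) has_integral
        \<mu> *\<^sub>R resolvent {x. \<exists>y. L x y} (\<lambda>x. THE y. L x y) (\<mu>\<^sup>2) x) {0..}"
      by (simp_all only: D_def A_def[abs_def] )
  qed
qed

section \<open>Second antiderivatives and the similarity transform\<close>

text \<open>
  Peano kernel: \<open>dbl_prim g\<close> is the second antiderivative of \<open>g\<close> that vanishes at the origin
  together with its derivative. It merges the integrals over \<open>{x..0}\<close> and \<open>{0..x}\<close> in
  \<^const>\<open>Delta_rel_fun\<close>.
\<close>

definition kern :: "real \<Rightarrow> real \<Rightarrow> real" where
  "kern x y = (if y \<ge> 0 then max 0 (x - y) else max 0 (y - x))"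

definition dbl_prim :: "(real \<Rightarrow> real) \<Rightarrow> real \<Rightarrow> real" where
  "dbl_prim g x = (\<integral>y. kern x y * g y \<partial>lborel)"

lemma kern_measurable [measurable]:
  assumes [measurable]: "f \<in> borel_measurable M" "g \<in> borel_measurable M"
  shows "(\<lambda>w. kern (f w) (g w)) \<in> borel_measurable M"
  unfolding kern_def by measurable

lemma kern_zero_left [simp]: "kern 0 y = 0"
  by (simp add: kern_def)

lemma kern_lipschitz: "\<bar>kern x y - kern x' y\<bar> \<le> \<bar>x - x'\<bar>"
  by (auto simp: kern_def)

lemma kern_le: "\<bar>kern x y\<bar> \<le> \<bar>x\<bar>"
  using kern_lipschitz[of x y 0] by simp

lemma kern_minus: "y \<noteq> 0 \<Longrightarrow> kern (- x) (- y) = kern x y"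
  by (auto simp: kern_def)

text \<open>The kernel vanishes unless \<open>y\<close> lies between \<open>0\<close> and
  \<open>x\<close>, where the two signs agree; \<open>y = 0\<close> is exceptional because
  \<open>sgn 0 = 0\<close>.\<close>

lemma kern_sgn: "y \<noteq> 0 \<Longrightarrow> kern x y * sgn y = sgn x * kern x y"
  by (auto simp: kern_def sgn_if)

text \<open>As a function of \<open>x\<close>, \<open>\<bar>x - y\<bar> / 2\<close> is a fundamental
  solution of the second derivative. The kernel is what remains after subtracting its first-order
  Taylor polynomial at \<open>x = 0\<close>, with the sign of \<open>y = 0\<close> taken as
  \<open>1\<close>.\<close>

lemma kern_eq: "kern x y = (\<bar>x - y\<bar> - \<bar>y\<bar> + x * (if y \<ge> 0 then 1 else -1)) / 2"
  by (auto simp: kern_def max_def abs_if)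

lemma bounded_mult_integrable:
  fixes k g :: "real \<Rightarrow> real"
  assumes "integrable lborel g" and [measurable]: "k \<in> borel_measurable borel"
    and "\<And>x. \<bar>k x\<bar> \<le> K"
  shows "integrable lborel (\<lambda>x. k x * g x)"
proof (rule Bochner_Integration.integrable_bound)
  show "integrable lborel (\<lambda>x. K * g x)" using assms by simp
  have [measurable]: "g \<in> borel_measurable borel"
    using assms(1) by (simp add: borel_measurable_integrable)
  show "(\<lambda>x. k x * g x) \<in> borel_measurable lborel"
    by measurable
  show "AE x in lborel. norm (k x * g x) \<le> norm (K * g x)"
    using order_trans[OF assms(3) abs_ge_self] by (intro AE_I2) (simp add: abs_mult mult_right_mono)
qed

lemma kern_integrable: "integrable lborel g \<Longrightarrow> integrable lborel (\<lambda>y. kern x y * g y)"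
  by (rule bounded_mult_integrable[OF _ _ kern_le]) auto

lemma dbl_prim_cong_AE:
  assumes "AE x in lborel. f x = g x" "integrable lborel f" "integrable lborel g"
  shows "dbl_prim f x = dbl_prim g x"
  unfolding dbl_prim_def
  using assms(1) borel_measurable_integrable[OF assms(2)] borel_measurable_integrable[OF assms(3)]
  by (intro integral_cong_AE) auto

lemma dbl_prim_add:
  assumes "integrable lborel f" "integrable lborel g"
  shows "dbl_prim (\<lambda>x. f x + g x) x = dbl_prim f x + dbl_prim g x"
  unfolding dbl_prim_def using assms by (simp add: distrib_left kern_integrable)

lemma dbl_prim_scale: "dbl_prim (\<lambda>x. c * f x) x = c * dbl_prim f x"
  unfolding dbl_prim_def by (simp add: mult.left_commute)

lemma dbl_prim_reflect:
  assumes [measurable]: "g \<in> borel_measurable borel"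
  shows "dbl_prim (\<lambda>y. g (- y)) x = dbl_prim g (- x)"
proof -
  have "dbl_prim (\<lambda>y. g (- y)) x = (\<integral>y. kern x (- y) * g y \<partial>lborel)"
    unfolding dbl_prim_def
    by (subst lborel_integral_real_affine[of "-1" _ 0]) simp_all
  also have "\<dots> = dbl_prim g (- x)"
    unfolding dbl_prim_def
  proof (rule integral_cong_AE)
    show "AE y in lborel. kern x (- y) * g y = kern (- x) y * g y"
      using AE_lborel_singleton[of 0] by eventually_elim (metis kern_minus minus_minus neg_equal_0_iff_equal)
  qed (use assms in auto)
  finally show ?thesis .
qed

lemma dbl_prim_sgn_mult:
  assumes [measurable]: "g \<in> borel_measurable borel"
  shows "dbl_prim (\<lambda>y. sgn y * g y) x = sgn x * dbl_prim g x"
proof -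
  have "dbl_prim (\<lambda>y. sgn y * g y) x = (\<integral>y. sgn x * (kern x y * g y) \<partial>lborel)"
    unfolding dbl_prim_def
  proof (rule integral_cong_AE)
    show "AE y in lborel. kern x y * (sgn y * g y) = sgn x * (kern x y * g y)"
      using AE_lborel_singleton[of 0] by eventually_elim (metis kern_sgn mult.assoc)
  qed auto
  then show ?thesis by (simp add: dbl_prim_def)
qed

lemma dbl_prim_lipschitz:
  assumes "integrable lborel g"
  shows "\<bar>dbl_prim g x - dbl_prim g x'\<bar> \<le> \<bar>x - x'\<bar> * (\<integral>y. \<bar>g y\<bar> \<partial>lborel)"
proof -
  have "dbl_prim g x - dbl_prim g x' = (\<integral>y. (kern x y - kern x' y) * g y \<partial>lborel)"
    unfolding dbl_prim_def using assms
    by (simp add: kern_integrable left_diff_distrib flip: Bochner_Integration.integral_diff)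
  also have "\<bar>\<dots>\<bar> \<le> (\<integral>y. \<bar>(kern x y - kern x' y) * g y\<bar> \<partial>lborel)"
    by (rule integral_abs_bound)
  also have "\<dots> \<le> (\<integral>y. \<bar>x - x'\<bar> * \<bar>g y\<bar> \<partial>lborel)"
    using assms by (intro integral_mono integrable_abs bounded_mult_integrable[OF _ _ kern_lipschitz])
      (auto simp: abs_mult kern_lipschitz mult_right_mono)
  finally show ?thesis by simp
qed

lemma continuous_dbl_prim: "integrable lborel g \<Longrightarrow> continuous_on S (dbl_prim g)"
  by (rule continuous_on_subset[OF lipschitz_on_continuous_on[where L = "\<integral>y. \<bar>g y\<bar> \<partial>lborel"]])
    (auto simp: lipschitz_on_def dist_real_def mult.commute[of "integral\<^sup>L _ _"] intro!: dbl_prim_lipschitz)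

lemma dbl_prim_pos:
  assumes [measurable]: "g \<in> borel_measurable borel" and "x > 0"
  shows "dbl_prim g x = (LBINT y:{0..x}. (x - y) * g y)"
  unfolding dbl_prim_def set_lebesgue_integral_def using assms(2)
  by (intro Bochner_Integration.integral_cong) (auto simp: kern_def indicator_def)

lemma dbl_prim_neg:
  assumes [measurable]: "g \<in> borel_measurable borel" and "x < 0"
  shows "dbl_prim g x = - (LBINT y:{x..0}. (x - y) * g y)"
proof -
  have "dbl_prim g x = (\<integral>y. - (indicator {x..0} y *\<^sub>R ((x - y) * g y)) \<partial>lborel)"
    unfolding dbl_prim_def
  proof (rule integral_cong_AE)
    show "AE y in lborel. kern x y * g y = - (indicator {x..0} y *\<^sub>R ((x - y) * g y))"
      using AE_lborel_singleton[of 0] by eventually_elim (use assms(2) in \<open>auto simp: kern_def indicator_def algebra_simps\<close>)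
  qed auto
  then show ?thesis by (simp add: set_lebesgue_integral_def)
qed

text \<open>A single identity for almost every \<open>x\<close> can be combined with its reflected
  copy, which the twist requires because it mixes the values at \<open>x\<close> and
  \<open>- x\<close>.\<close>

lemma Delta_rel_fun_iff:
  assumes "g \<in> borel_measurable borel"
  shows "Delta_rel_fun p q f g \<longleftrightarrow>
    (\<exists>C D. AE x in lborel. f x = (if x < 0 then q else p) * C + D * x + dbl_prim g x)"
proof -
  have "(AE x in lborel.
     (x < 0 \<longrightarrow> f x = q * C + D * x - (LBINT y:{x..0}. (x - y) * g y)) \<and>
     (x > 0 \<longrightarrow> f x = p * C + D * x + (LBINT y:{0..x}. (x - y) * g y))) \<longleftrightarrow>
    (AE x in lborel. f x = (if x < 0 then q else p) * C + D * x + dbl_prim g x)" for C D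
    using AE_lborel_singleton[of 0]
    by (intro eventually_subst, eventually_elim) (auto simp: dbl_prim_pos[OF assms] dbl_prim_neg[OF assms])
  then show ?thesis by (simp add: Delta_rel_fun_def)
qed

section \<open>The similarity \<open>I + b J\<close> and its effect on the transmission
  condition\<close>

definition twist_fun :: "real \<Rightarrow> (real \<Rightarrow> real) \<Rightarrow> real \<Rightarrow> real" where
  "twist_fun b f x = f x + b * (sgn x * (f x + f (- x)) / 2)"

lemma AE_lborel_uminus: "AE x in lborel. P x \<Longrightarrow> AE x in lborel. P (- x :: real)"
  using AE_lborel_affine[of P "-1" 0] by simp

lemma integrable_uminus_arg: "integrable lborel f \<Longrightarrow> integrable lborel (\<lambda>x. f (- x :: real) :: real)"
  using lborel_integrable_real_affine[of f "-1" 0] by simp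

lemma integrable_sgn_mult: "integrable lborel f \<Longrightarrow> integrable lborel (\<lambda>x. sgn x * f x :: real)"
  by (rule bounded_mult_integrable[where K = 1]) (auto simp: sgn_if)

lemma integrable_twist: "integrable lborel f \<Longrightarrow> integrable lborel (twist_fun b f)"
  unfolding twist_fun_def
  by (intro Bochner_Integration.integrable_add integrable_mult_right integrable_divide integrable_sgn_mult
      integrable_uminus_arg)

text \<open>J is composed of reflection and multiplication by the sign. The second antiderivative
  commutes with both because it is based at the origin, the fixed point of the reflection.\<close>

lemma dbl_prim_twist:
  assumes g: "integrable lborel g"
  shows "dbl_prim (twist_fun b g) x = twist_fun b (dbl_prim g) x"
proof -
  note [measurable] = borel_measurable_integrable[OF g, simplified]
  have i: "integrable lborel (\<lambda>x. g x + g (- x))"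
    by (intro Bochner_Integration.integrable_add g integrable_uminus_arg)
  have "dbl_prim (twist_fun b g) x = dbl_prim g x + dbl_prim (\<lambda>x. b / 2 * (sgn x * (g x + g (- x)))) x"
    unfolding twist_fun_def using integrable_sgn_mult[OF i]
    by (subst dbl_prim_add[symmetric]) (auto intro: g)
  also have "dbl_prim (\<lambda>x. b / 2 * (sgn x * (g x + g (- x)))) x = b / 2 * (sgn x * dbl_prim (\<lambda>x. g x + g (- x)) x)"
    by (subst dbl_prim_scale, subst dbl_prim_sgn_mult) simp_all
  also have "dbl_prim (\<lambda>x. g x + g (- x)) x = dbl_prim g x + dbl_prim g (- x)"
    by (simp add: dbl_prim_add g integrable_uminus_arg dbl_prim_reflect)
  finally show ?thesis by (simp add: twist_fun_def[of b "dbl_prim g"])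
qed

text \<open>Only the one-sided constants change. They determine \<open>(p, q)\<close> up to a common
  factor, and \<open>c\<close> moves this factor into the free constant \<open>C\<close>. The
  hypotheses in this form serve both for passing to the pair \<open>(1, 1)\<close> and for returning
  from it.\<close>

lemma Delta_rel_fun_twist:
  assumes g: "integrable lborel g"
    and p': "p' * c = p + b * (p + q) / 2" and q': "q' * c = q - b * (p + q) / 2"
    and rel: "Delta_rel_fun p q f g"
  shows "Delta_rel_fun p' q' (twist_fun b f) (twist_fun b g)"
proof -
  obtain C D where *: "AE x in lborel. f x = (if x < 0 then q else p) * C + D * x + dbl_prim g x"
    using rel Delta_rel_fun_iff g by (auto dest: borel_measurable_integrable)
  have "AE x in lborel. twist_fun b f x =
      (if x < 0 then q' else p') * (c * C) + D * x + dbl_prim (twist_fun b g) x"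
    using * AE_lborel_uminus[OF *] AE_lborel_singleton[of 0]
  proof eventually_elim
    case (elim x)
    have eqs: "q' * (c * C) = (q - b * (p + q) / 2) * C" "p' * (c * C) = (p + b * (p + q) / 2) * C"
      using p' q' by (simp_all flip: mult.assoc)
    consider "x < 0" | "x > 0" using elim(3) by linarith
    then show ?case
    proof cases
      case 1
      then have f: "f x = q * C + D * x + dbl_prim g x" "f (- x) = p * C - D * x + dbl_prim g (- x)"
        using elim(1,2) by simp_all
      have "twist_fun b f x = (q - b * (p + q) / 2) * C + D * x + twist_fun b (dbl_prim g) x"
        unfolding twist_fun_def f using 1 by (simp add: field_simps)
      then show ?thesis using 1 by (simp only: eqs dbl_prim_twist[OF g] if_True)
    next
      case 2
      then have f: "f x = p * C + D * x + dbl_prim g x" "f (- x) = q * C - D * x + dbl_prim g (- x)"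
        using elim(1,2) by simp_all
      have "twist_fun b f x = (p + b * (p + q) / 2) * C + D * x + twist_fun b (dbl_prim g) x"
        unfolding twist_fun_def f using 2 by (simp add: field_simps)
      moreover have "\<not> x < 0" using 2 by simp
      ultimately show ?thesis by (simp only: eqs dbl_prim_twist[OF g] if_False)
    qed
  qed
  then show ?thesis
    using borel_measurable_integrable[OF integrable_twist[OF g, of b]]
    by (subst Delta_rel_fun_iff) (auto simp del: AE_conj_iff split del: if_split)
qed

lift_definition twist :: "real \<Rightarrow> L1 \<Rightarrow> L1" is twist_fun
proof -
  fix b and f g :: "real \<Rightarrow> real" assume "L1_rel f g"
  then have *: "integrable lborel f" "integrable lborel g" and eq: "AE x in lborel. f x = g x"
    by (auto simp: L1_rel_def)
  have "AE x in lborel. twist_fun b f x = twist_fun b g x"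
    using eq AE_lborel_uminus[OF eq] by eventually_elim (simp add: twist_fun_def)
  with * show "L1_rel (twist_fun b f) (twist_fun b g)"
    by (simp add: L1_rel_def integrable_twist)
qed

lemma Delta_rel_twist:
  assumes "p' * c = p + b * (p + q) / 2" "q' * c = q - b * (p + q) / 2"
  shows "Delta_rel p q \<phi> \<psi> \<Longrightarrow> Delta_rel p' q' (twist b \<phi>) (twist b \<psi>)"
proof (transfer fixing: p q p' q' b)
  fix f g assume "L1_rel g g" "Delta_rel_fun p q f g"
  then show "Delta_rel_fun p' q' (twist_fun b f) (twist_fun b g)"
    by (intro Delta_rel_fun_twist[OF _ assms]) (simp_all add: L1_rel_def)
qed

lemma twist_fun_inverse: "x \<noteq> 0 \<Longrightarrow> twist_fun (- b) (twist_fun b f) x = f x"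
  by (simp add: twist_fun_def sgn_if field_simps)

lemma twist_inverse: "twist (- b) (twist b \<phi>) = \<phi>"
proof transfer
  fix b and f :: "real \<Rightarrow> real" assume "L1_rel f f"
  moreover have "AE x in lborel. twist_fun (- b) (twist_fun b f) x = f x"
    using AE_lborel_singleton[of 0] by eventually_elim (rule twist_fun_inverse)
  ultimately show "L1_rel (twist_fun (- b) (twist_fun b f)) f"
    by (simp add: L1_rel_def integrable_twist)
qed

lemma twist_fun_add: "twist_fun b (\<lambda>x. f x + g x) = (\<lambda>x. twist_fun b f x + twist_fun b g x)"
  by (simp add: twist_fun_def fun_eq_iff algebra_simps add_divide_distrib)

lemma twist_fun_scale: "twist_fun b (\<lambda>x. c * f x) = (\<lambda>x. c * twist_fun b f x)"
  by (simp add: twist_fun_def fun_eq_iff algebra_simps add_divide_distrib)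

lemma bounded_linear_twist: "bounded_linear (twist b)"
proof (rule bounded_linear_intro[where K = "1 + \<bar>b\<bar>"])
  show "twist b (\<phi> + \<psi>) = twist b \<phi> + twist b \<psi>" for \<phi> \<psi>
    by transfer (simp add: L1_rel_def integrable_twist twist_fun_add)
  show "twist b (c *\<^sub>R \<phi>) = c *\<^sub>R twist b \<phi>" for c \<phi>
    by transfer (simp add: L1_rel_def integrable_twist twist_fun_scale)
  show "norm (twist b \<phi>) \<le> norm \<phi> * (1 + \<bar>b\<bar>)" for \<phi>
  proof transfer
    fix b and f :: "real \<Rightarrow> real" assume "L1_rel f f"
    then have f: "integrable lborel f" by (simp add: L1_rel_def)
    note f' = integrable_uminus_arg[OF f]
    have "(\<integral>x. \<bar>twist_fun b f x\<bar> \<partial>lborel) \<le> (\<integral>x. \<bar>f x\<bar> + \<bar>b\<bar> / 2 * (\<bar>f x\<bar> + \<bar>f (- x)\<bar>) \<partial>lborel)"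
    proof (rule integral_mono)
      show "\<bar>twist_fun b f x\<bar> \<le> \<bar>f x\<bar> + \<bar>b\<bar> / 2 * (\<bar>f x\<bar> + \<bar>f (- x)\<bar>)" for x
      proof -
        have "\<bar>sgn x * (f x + f (- x))\<bar> \<le> \<bar>f x\<bar> + \<bar>f (- x)\<bar>"
          by (auto simp: sgn_if)
        then have "\<bar>b / 2\<bar> * \<bar>sgn x * (f x + f (- x))\<bar> \<le> \<bar>b / 2\<bar> * (\<bar>f x\<bar> + \<bar>f (- x)\<bar>)"
          by (rule mult_left_mono) simp
        then have "\<bar>b / 2 * (sgn x * (f x + f (- x)))\<bar> \<le> \<bar>b\<bar> / 2 * (\<bar>f x\<bar> + \<bar>f (- x)\<bar>)"
          unfolding abs_mult by simp
        then show ?thesis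
          unfolding twist_fun_def using abs_triangle_ineq[of "f x" "b / 2 * (sgn x * (f x + f (- x)))"] by simp
      qed
    qed (use f f' in \<open>auto intro!: integrable_twist\<close>)
    also have "\<dots> = (\<integral>x. \<bar>f x\<bar> \<partial>lborel) + \<bar>b\<bar> / 2 * ((\<integral>x. \<bar>f x\<bar> \<partial>lborel) + (\<integral>x. \<bar>f (- x)\<bar> \<partial>lborel))"
      using f f' by simp
    also have "(\<integral>x. \<bar>f (- x)\<bar> \<partial>lborel) = (\<integral>x. \<bar>f x\<bar> \<partial>lborel)"
      by (subst (2) lborel_integral_real_affine[of "-1" _ 0]) simp_all
    finally show "(\<integral>x. \<bar>twist_fun b f x\<bar> \<partial>lborel) \<le> (\<integral>x. \<bar>f x\<bar> \<partial>lborel) * (1 + \<bar>b\<bar>)"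
      by (simp add: field_simps)
  qed
qed

section \<open>Translations\<close>

definition shift_fun :: "real \<Rightarrow> (real \<Rightarrow> real) \<Rightarrow> real \<Rightarrow> real" where
  "shift_fun t f x = f (x + t)"

lemma AE_lborel_shift: "AE x in lborel. P x \<Longrightarrow> AE x in lborel. P (x + t :: real)"
  using AE_lborel_affine[of P 1 t] by (simp add: add.commute)

lemma integrable_shift: "integrable lborel f \<Longrightarrow> integrable lborel (shift_fun t f)"
  using lborel_integrable_real_affine[of f 1 t] by (simp add: add.commute shift_fun_def[abs_def])

lemma integral_abs_shift: "(\<integral>x. \<bar>shift_fun t f x\<bar> \<partial>lborel) = (\<integral>x. \<bar>f x\<bar> \<partial>lborel)"
  by (subst (2) lborel_integral_real_affine[of 1 _ t]) (simp_all add: shift_fun_def add.commute)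

lift_definition shift :: "real \<Rightarrow> L1 \<Rightarrow> L1" is shift_fun
proof -
  fix t and f g :: "real \<Rightarrow> real" assume "L1_rel f g"
  then show "L1_rel (shift_fun t f) (shift_fun t g)"
    using AE_lborel_shift[of "\<lambda>x. f x = g x" t]
    by (auto simp: L1_rel_def integrable_shift) (simp add: shift_fun_def)
qed

lemma shift_abs_L1: "integrable lborel f \<Longrightarrow> shift t (abs_L1 f) = abs_L1 (shift_fun t f)"
  by (simp add: L1_rel_refl shift.abs_eq)

lemma shift_shift: "shift s (shift t \<phi>) = shift (s + t) \<phi>"
proof transfer
  show "L1_rel f f \<Longrightarrow> L1_rel (shift_fun s (shift_fun t f)) (shift_fun (s + t) f)" for s t f
    by (simp add: L1_rel_def integrable_shift) (simp add: shift_fun_def add.assoc)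
qed

lemma shift_zero: "shift 0 \<phi> = \<phi>"
proof transfer
  show "L1_rel f f \<Longrightarrow> L1_rel (shift_fun 0 f) f" for f
    by (simp add: L1_rel_def integrable_shift) (simp add: shift_fun_def)
qed

lemma norm_shift: "norm (shift t \<phi>) = norm \<phi>"
  by transfer (rule integral_abs_shift)

lemma shift_add: "shift t (\<phi> + \<psi>) = shift t \<phi> + shift t \<psi>"
proof transfer
  fix t and f g :: "real \<Rightarrow> real" assume "L1_rel f f" "L1_rel g g"
  then have "integrable lborel (shift_fun t f)" "integrable lborel (shift_fun t g)"
    by (auto simp: L1_rel_def integrable_shift)
  then have "integrable lborel (\<lambda>x. shift_fun t f x + shift_fun t g x)"
    by simp
  moreover have "(\<lambda>x. shift_fun t f x + shift_fun t g x) = shift_fun t (\<lambda>x. f x + g x)"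
    by (simp add: shift_fun_def fun_eq_iff)
  ultimately show "L1_rel (shift_fun t (\<lambda>x. f x + g x)) (\<lambda>x. shift_fun t f x + shift_fun t g x)"
    by (simp add: L1_rel_refl)
qed

lemma shift_scale: "shift t (c *\<^sub>R \<phi>) = c *\<^sub>R shift t \<phi>"
proof transfer
  fix t c and f :: "real \<Rightarrow> real" assume "L1_rel f f"
  then have "integrable lborel (\<lambda>x. c * shift_fun t f x)"
    by (simp add: L1_rel_def integrable_shift)
  moreover have "(\<lambda>x. c * shift_fun t f x) = shift_fun t (\<lambda>x. c * f x)"
    by (simp add: shift_fun_def fun_eq_iff)
  ultimately show "L1_rel (shift_fun t (\<lambda>x. c * f x)) (\<lambda>x. c * shift_fun t f x)"
    by (simp add: L1_rel_refl)
qed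

lemma bounded_linear_shift: "bounded_linear (shift t)"
  by (rule bounded_linear_intro[where K = 1]) (simp_all add: shift_add shift_scale norm_shift)

lemma L1_norm_diff:
  assumes "integrable lborel f" "integrable lborel g"
  shows "norm (abs_L1 f - abs_L1 g) = (\<integral>x. \<bar>f x - g x\<bar> \<partial>lborel)"
  using assms by (simp add: L1_rel_refl minus_L1.abs_eq norm_abs_L1)

text \<open>Three-epsilon argument: since translations are isometric, the error of replacing
  \<open>\<phi>\<close> by \<open>\<psi>\<close> is uniform in \<open>n\<close>.\<close>

lemma shift_tendsto_approx:
  assumes approx: "\<And>e. e > 0 \<Longrightarrow> \<exists>\<psi>. norm (\<phi> - \<psi>) < e \<and> (\<lambda>n. shift (t n) \<psi>) \<longlonglongrightarrow> \<psi>"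
  shows "(\<lambda>n. shift (t n) \<phi>) \<longlonglongrightarrow> \<phi>"
proof (rule tendstoI)
  fix e :: real assume "e > 0"
  then obtain \<psi> where \<psi>: "norm (\<phi> - \<psi>) < e / 3" "(\<lambda>n. shift (t n) \<psi>) \<longlonglongrightarrow> \<psi>"
    using approx[of "e / 3"] by auto
  have "\<forall>\<^sub>F n in sequentially. dist (shift (t n) \<psi>) \<psi> < e / 3"
    using \<psi>(2) \<open>e > 0\<close> by (intro tendstoD) auto
  then show "\<forall>\<^sub>F n in sequentially. dist (shift (t n) \<phi>) \<phi> < e"
  proof eventually_elim
    case (elim n)
    have "shift (t n) \<phi> - \<phi> = shift (t n) (\<phi> - \<psi>) + (shift (t n) \<psi> - \<psi>) - (\<phi> - \<psi>)"
      by (simp add: linear_diff[OF bounded_linear.linear[OF bounded_linear_shift]])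
    also have "norm \<dots> \<le> norm (\<phi> - \<psi>) + norm (shift (t n) \<psi> - \<psi>) + norm (\<phi> - \<psi>)"
      by (intro order_trans[OF norm_triangle_ineq4] order_trans[OF norm_triangle_ineq] add_mono order_refl)
        (simp add: norm_shift)
    finally show ?case using \<psi>(1) elim by (simp add: dist_norm)
  qed
qed

text \<open>
  For open \<open>U\<close> the indicator is lower semicontinuous, so \<open>U \<inter> (U - t)\<close> exhausts \<open>U\<close> as \<open>t\<close> tends to 0.
\<close>

lemma shift_tendsto_open:
  assumes "open U" "emeasure lborel U < \<infinity>" and t: "t \<longlonglongrightarrow> 0"
  shows "(\<lambda>n. shift (t n) (abs_L1 (indicator U))) \<longlonglongrightarrow> abs_L1 (indicator U)"
proof -
  let ?u = "indicator U :: real \<Rightarrow> real"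
  have U[measurable]: "U \<in> sets borel" using assms(1) by simp
  have u: "integrable lborel ?u" using assms(2) by simp
  note us = integrable_shift[OF u]
  have uu: "integrable lborel (\<lambda>x. ?u x * shift_fun s ?u x)" for s
    by (rule bounded_mult_integrable[OF us, where K = 1]) (auto simp: indicator_def)
  have sh: "(\<integral>x. shift_fun s ?u x \<partial>lborel) = (\<integral>x. ?u x \<partial>lborel)" for s
    using integral_abs_shift[of s ?u] by (simp add: shift_fun_def)
  \<comment> \<open>For numbers in \<open>{0, 1}\<close> the distance of \<open>a\<close> and
    \<open>b\<close> is \<open>a + b - 2 * a * b\<close>, and translation preserves the measure of
    \<open>U\<close>.\<close>
  have "norm (shift s (abs_L1 ?u) - abs_L1 ?u) = 2 * ((\<integral>x. ?u x \<partial>lborel) - (\<integral>x. ?u x * shift_fun s ?u x \<partial>lborel))" for s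
  proof -
    have "norm (shift s (abs_L1 ?u) - abs_L1 ?u) =
        (\<integral>x. shift_fun s ?u x + ?u x - 2 * (?u x * shift_fun s ?u x) \<partial>lborel)"
      unfolding shift_abs_L1[OF u] L1_norm_diff[OF us u]
      by (intro Bochner_Integration.integral_cong) (auto simp: shift_fun_def indicator_def)
    also have "\<dots> = (\<integral>x. shift_fun s ?u x \<partial>lborel) + (\<integral>x. ?u x \<partial>lborel) - 2 * (\<integral>x. ?u x * shift_fun s ?u x \<partial>lborel)"
      using u us uu by simp
    finally show ?thesis by (simp add: sh)
  qed
  moreover have "(\<lambda>n. \<integral>x. ?u x * shift_fun (t n) ?u x \<partial>lborel) \<longlonglongrightarrow> (\<integral>x. ?u x \<partial>lborel)"
  proof (rule integral_dominated_convergence[where w = ?u])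
    \<comment> \<open>The factor \<open>?u x\<close> confines the argument to points of the open
      set. Boundary points of \<open>U\<close>, where the indicator jumps, contribute only
      zeros.\<close>
    show "AE x in lborel. (\<lambda>n. ?u x * shift_fun (t n) ?u x) \<longlonglongrightarrow> ?u x"
    proof (rule AE_I2)
      fix x
      show "(\<lambda>n. ?u x * shift_fun (t n) ?u x) \<longlonglongrightarrow> ?u x"
      proof (cases "x \<in> U")
        case True
        have "(\<lambda>n. x + t n) \<longlonglongrightarrow> x + 0" by (intro tendsto_intros t)
        then have "\<forall>\<^sub>F n in sequentially. x + t n \<in> U"
          using True assms(1) by (auto dest: topological_tendstoD)
        then show ?thesis
          by (intro tendsto_eventually, eventually_elim) (simp add: shift_fun_def True)
      qed simp
    qed
    show "AE x in lborel. norm (?u x * shift_fun (t n) ?u x) \<le> ?u x" for n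
      by (auto simp: shift_fun_def indicator_def)
    show "(\<lambda>x. ?u x * shift_fun (t n) ?u x) \<in> borel_measurable lborel" for n
      using uu by (rule borel_measurable_integrable)
  qed (use u in auto)
  then have "(\<lambda>n. 2 * ((\<integral>x. ?u x \<partial>lborel) - (\<integral>x. ?u x * shift_fun (t n) ?u x \<partial>lborel))) \<longlonglongrightarrow>
      2 * ((\<integral>x. ?u x \<partial>lborel) - (\<integral>x. ?u x \<partial>lborel))"
    by (intro tendsto_intros)
  ultimately have "(\<lambda>n. norm (shift (t n) (abs_L1 ?u) - abs_L1 ?u)) \<longlonglongrightarrow> 0"
    by simp
  then show ?thesis
    by (metis tendsto_norm_zero_iff LIM_zero_cancel)
qed

text \<open>Density argument along the induction rule for integrable functions. Outer regularity
  reduces the indicator of a Borel set of finite measure to that of an open superset.\<close>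

lemma shift_tendsto:
  assumes t: "t \<longlonglongrightarrow> 0"
  shows "(\<lambda>n. shift (t n) \<phi>) \<longlonglongrightarrow> \<phi>"
proof -
  have "(\<lambda>n. shift (t n) (abs_L1 f)) \<longlonglongrightarrow> abs_L1 f" if "integrable lborel f" for f
    using that
  proof induction
    case (base A c)
    have ind: "integrable lborel (indicator A :: real \<Rightarrow> real)"
      using base by simp
    have "(\<lambda>n. shift (t n) (abs_L1 (indicator A))) \<longlonglongrightarrow> abs_L1 (indicator A)"
    proof (rule shift_tendsto_approx)
      fix e :: real assume "e > 0"
      obtain U where U: "open U" "A \<subseteq> U" "emeasure lborel (U - A) < ennreal e"
        using outer_regular_lborel[of A e] base(1) \<open>e > 0\<close> by auto
      have [measurable]: "U \<in> sets borel" "A \<in> sets borel" using U(1) base(1) by auto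
      have fin: "emeasure lborel (U - A) < \<infinity>"
        using U(3) less_top order_less_trans by fastforce
      have "emeasure lborel U = emeasure lborel A + emeasure lborel (U - A)"
        using U(2) by (subst plus_emeasure) (auto simp: Un_absorb1)
      then have Ufin: "emeasure lborel U < \<infinity>"
        using base(2) fin by simp
      then have Ui: "integrable lborel (indicator U :: real \<Rightarrow> real)" by simp
      have "norm (abs_L1 (indicator A) - abs_L1 (indicator U)) = (\<integral>x. indicator (U - A) x \<partial>lborel)"
        unfolding L1_norm_diff[OF ind Ui]
        by (intro Bochner_Integration.integral_cong) (use U(2) in \<open>auto simp: indicator_def\<close>)
      also have "\<dots> = measure lborel (U - A)" by simp
      also have "\<dots> < e"
        using U(3) \<open>e > 0\<close> by (metis emeasure_eq_ennreal_measure ennreal_less_iff fin infinity_ennreal_def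
            less_irrefl measure_nonneg)
      finally show "\<exists>\<psi>. norm (abs_L1 (indicator A) - \<psi>) < e \<and> (\<lambda>n. shift (t n) \<psi>) \<longlonglongrightarrow> \<psi>"
        using shift_tendsto_open[OF U(1) Ufin t] by blast
    qed
    then have "(\<lambda>n. c *\<^sub>R shift (t n) (abs_L1 (indicator A))) \<longlonglongrightarrow> c *\<^sub>R abs_L1 (indicator A)"
      by (intro tendsto_intros)
    moreover have "abs_L1 (\<lambda>x. indicator A x *\<^sub>R c) = c *\<^sub>R abs_L1 (indicator A)"
      using ind by (simp add: L1_rel_refl scaleR_L1.abs_eq mult.commute)
    ultimately show ?case by (simp add: shift_scale)
  next
    case (add f g)
    then have "abs_L1 (\<lambda>x. f x + g x) = abs_L1 f + abs_L1 g"
      by (simp add: L1_rel_refl plus_L1.abs_eq)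
    then show ?case using add tendsto_add by (simp add: shift_add)
  next
    case (lim f s)
    show ?case
    proof (rule shift_tendsto_approx)
      fix e :: real assume "e > 0"
      have "(\<lambda>i. \<integral>x. \<bar>f x - s i x\<bar> \<partial>lborel) \<longlonglongrightarrow> (\<integral>x. 0 \<partial>(lborel :: real measure))"
      \<comment> \<open>The approximants of the induction rule satisfy
        \<open>\<bar>s i x\<bar> \<le> 2 * \<bar>f x\<bar>\<close>, whence the factor 3.\<close>
      proof (rule integral_dominated_convergence[where w = "\<lambda>x. 3 * \<bar>f x\<bar>"])
        show "AE x in lborel. (\<lambda>i. \<bar>f x - s i x\<bar>) \<longlonglongrightarrow> 0"
        proof (rule AE_I2)
          fix x :: real
          have "(\<lambda>i. s i x) \<longlonglongrightarrow> f x"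
            using lim.hyps(2)[of x] by simp
          then have "(\<lambda>i. \<bar>f x - s i x\<bar>) \<longlonglongrightarrow> \<bar>f x - f x\<bar>"
            by (intro tendsto_intros)
          then show "(\<lambda>i. \<bar>f x - s i x\<bar>) \<longlonglongrightarrow> 0" by simp
        qed
        show "AE x in lborel. norm \<bar>f x - s i x\<bar> \<le> 3 * \<bar>f x\<bar>" for i
        proof (rule AE_I2)
          fix x
          show "norm \<bar>f x - s i x\<bar> \<le> 3 * \<bar>f x\<bar>"
            using lim.hyps(3)[of x i] by simp
        qed
      qed (use lim.hyps(1,4) in auto)
      then have "\<forall>\<^sub>F i in sequentially. (\<integral>x. \<bar>f x - s i x\<bar> \<partial>lborel) < e"
        using \<open>e > 0\<close> by (intro order_tendstoD) auto
      then obtain i where "(\<integral>x. \<bar>f x - s i x\<bar> \<partial>lborel) < e"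
        by (meson eventually_happens sequentially_bot)
      then show "\<exists>\<psi>. norm (abs_L1 f - \<psi>) < e \<and> (\<lambda>n. shift (t n) \<psi>) \<longlonglongrightarrow> \<psi>"
        using lim.hyps(1,4) lim.IH L1_norm_diff[of f "s i"] by (intro exI[of _ "abs_L1 (s i)"]) auto
    qed
  qed
  from this[OF integrable_rep_L1[of \<phi>]] show ?thesis by simp
qed

lemma continuous_shift: "continuous_on UNIV (\<lambda>t. shift t \<phi>)"
  unfolding continuous_on_sequentially
proof (intro allI impI ballI)
  fix x :: "nat \<Rightarrow> real" and a
  assume "(\<forall>n. x n \<in> UNIV) \<and> x \<longlonglongrightarrow> a"
  then have "(\<lambda>n. x n - a) \<longlonglongrightarrow> 0" by (simp add: LIM_zero)
  from shift_tendsto[OF this, of "shift a \<phi>"]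
  show "((\<lambda>t. shift t \<phi>) \<circ> x) \<longlonglongrightarrow> shift a \<phi>"
    by (simp add: shift_shift o_def)
qed

section \<open>\<open>Cpq\<close> as a conjugate of the translation family\<close>

lemma Cpq_eq:
  assumes "p + q \<noteq> 0" and b: "b = (q - p) / (p + q)"
  shows "Cpq p q t \<phi> = twist (- b) ((1/2) *\<^sub>R (shift t (twist b \<phi>) + shift (- t) (twist b \<phi>)))"
proof -
  define s where "s = \<bar>t\<bar>"
  have s: "s \<ge> 0" by (simp add: s_def)
  have sym: "shift t (twist b \<phi>) + shift (- t) (twist b \<phi>) = shift s (twist b \<phi>) + shift (- s) (twist b \<phi>)"
    by (cases "t \<ge> 0") (simp_all add: s_def add.commute)
  have "L1_rel (Cpq_fun p q t f)
    (twist_fun (- b) (\<lambda>x. 1/2 * (shift_fun s (twist_fun b f) x + shift_fun (- s) (twist_fun b f) x)))"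
    if "L1_rel f f" for f
  proof -
    have f: "integrable lborel f" using that by (simp add: L1_rel_def)
    have b': "b / 2 = (q - p) / (2 * (p + q))" "- b / 2 = (p - q) / (2 * (p + q))"
      using assms by (simp_all add: field_simps)
    have i: "integrable lborel (\<lambda>x. 1/2 * (shift_fun s (twist_fun b f) x + shift_fun (- s) (twist_fun b f) x))"
      using f by (intro integrable_mult_right Bochner_Integration.integrable_add integrable_shift integrable_twist)
    have "AE x in lborel. Cpq_fun p q t f x = twist_fun (- b) (\<lambda>x. 1/2 * (shift_fun s (twist_fun b f) x + shift_fun (- s) (twist_fun b f) x)) x"
      \<comment> \<open>Off these three points none of \<open>x\<close>, \<open>x + s\<close> and
        \<open>x - s\<close> vanishes, so every occurrence of \<open>sgn\<close> is \<open>1\<close>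
        or \<open>-1\<close>.\<close>
      using AE_lborel_singleton[of 0] AE_lborel_singleton[of s] AE_lborel_singleton[of "- s"]
    proof eventually_elim
      case (elim x)
      have e: "- x + s = s - x" "- x - s = - s - x" "- (x + s) = - s - x" "- (x - s) = s - x" by simp_all
      show ?case
        unfolding Cpq_fun_def Let_def s_def[symmetric] b'[symmetric]
        using elim s
        by (simp add: twist_fun_def shift_fun_def sgn_if algebra_simps) (auto simp: field_simps)
    qed
    then show ?thesis
      using f i by (simp add: L1_rel_def Cpq_fun_integrable integrable_twist)
  qed
  then have "Cpq p q t \<phi> = twist (- b) ((1/2) *\<^sub>R (shift s (twist b \<phi>) + shift (- s) (twist b \<phi>)))"
    by transfer
  then show ?thesis by (simp add: sym)
qed

section \<open>The resolvent of the second derivative\<close>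

text \<open>The decaying fundamental solution of \<mu>^2 - d^2/dx^2, normalised so that its
  derivative drops by 1 at the origin.\<close>

definition kexp :: "real \<Rightarrow> real \<Rightarrow> real" where
  "kexp \<mu> v = exp (- \<mu> * \<bar>v\<bar>) / (2 * \<mu>)"

definition kconv :: "real \<Rightarrow> (real \<Rightarrow> real) \<Rightarrow> real \<Rightarrow> real" where
  "kconv \<mu> h x = (\<integral>z. kexp \<mu> (x - z) * h z \<partial>lborel)"

lemma kexp_measurable [measurable]: "kexp \<mu> \<in> borel_measurable borel"
  unfolding kexp_def by measurable

lemma kexp_minus [simp]: "kexp \<mu> (- v) = kexp \<mu> v"
  by (simp add: kexp_def)

lemma kexp_le: "\<mu> > 0 \<Longrightarrow> \<bar>kexp \<mu> v\<bar> \<le> 1 / (2 * \<mu>)"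
  by (simp add: kexp_def field_simps)

lemma integrable_exp_abs:
  fixes \<mu> :: real
  assumes "\<mu> > 0"
  shows "integrable lborel (\<lambda>v. exp (- \<mu> * \<bar>v\<bar>))"
proof -
  have *: "set_integrable lborel {0..} (\<lambda>v. exp (- \<mu> * v))"
    using integrable_on_exp_minus_to_infinity[OF assms, of 0] nonnegative_absolutely_integrable_1[of "\<lambda>v. exp (- \<mu> * v)" "{0..}"]
    unfolding set_integrable_def by (auto simp: integrable_completion)
  then have r: "integrable lborel (\<lambda>v. indicator {0..} v * exp (- \<mu> * v))"
    by (simp add: set_integrable_def)
  have "integrable lborel (\<lambda>v. indicator {0..} v * exp (- \<mu> * v) + indicator {0..} (- v) * exp (- \<mu> * (- v)))"
    by (intro Bochner_Integration.integrable_add r integrable_uminus_arg[OF r])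
  then show ?thesis
  \<comment> \<open>At \<open>v = 0\<close> both indicators are \<open>1\<close>, so the sum
    dominates the exponential there without being equal to it.\<close>
  proof (rule Bochner_Integration.integrable_bound)
    show "AE v in lborel. norm (exp (- \<mu> * \<bar>v\<bar>)) \<le>
      norm (indicator {0..} v * exp (- \<mu> * v) + indicator {0..} (- v) * exp (- \<mu> * (- v)))"
      by (auto simp: indicator_def abs_if)
  qed simp
qed

lemma kexp_integrable: "\<mu> > 0 \<Longrightarrow> integrable lborel (kexp \<mu>)"
  unfolding kexp_def by (intro integrable_divide integrable_exp_abs)

text \<open>Tonelli: by affine substitution the inner integral of the absolute value is a constant
  multiple of \<open>\<bar>h z\<bar>\<close>, and a bounded factor preserves integrability. The case
  \<open>c = -1\<close> serves the convolution, and \<open>c = 1\<close> the averages of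
  translates.\<close>

lemma integrable_product_conv:
  fixes k g h :: "real \<Rightarrow> real" and c :: real
  assumes k: "integrable lborel k" and h: "integrable lborel h" and [measurable]: "g \<in> borel_measurable borel"
    and g: "\<And>y. \<bar>g y\<bar> \<le> K" and c: "c \<noteq> 0"
  shows "integrable (lborel \<Otimes>\<^sub>M lborel) (\<lambda>(z, y). g y * k (z + c * y) * h z)"
proof -
  note [measurable] = borel_measurable_integrable[OF k, simplified] borel_measurable_integrable[OF h, simplified]
  have kz: "integrable lborel (\<lambda>y. k (z + c * y))" for z
    by (rule lborel_integrable_real_affine[OF k c])
  have "integrable (lborel \<Otimes>\<^sub>M lborel) (\<lambda>(z, y). k (z + c * y) * h z)"
  proof (rule lborel_pair.Fubini_integrable)
    have "(\<integral>y. \<bar>k (z + c * y) * h z\<bar> \<partial>lborel) = (\<integral>y. \<bar>k y\<bar> \<partial>lborel) / \<bar>c\<bar> * \<bar>h z\<bar>" for z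
      using c by (subst (2) lborel_integral_real_affine[of c _ z]) (simp_all add: abs_mult)
    then show "integrable lborel (\<lambda>z. \<integral>y. norm (case (z, y) of (z, y) \<Rightarrow> k (z + c * y) * h z) \<partial>lborel)"
      using h by simp
    show "AE z in lborel. integrable lborel (\<lambda>y. case (z, y) of (z, y) \<Rightarrow> k (z + c * y) * h z)"
      using kz by simp
  qed simp
  then have "integrable (lborel \<Otimes>\<^sub>M lborel) (\<lambda>w. K * (case w of (z, y) \<Rightarrow> k (z + c * y) * h z))"
    by simp
  then show ?thesis
  proof (rule Bochner_Integration.integrable_bound)
    have "\<bar>g y\<bar> \<le> \<bar>K\<bar>" for y using g[of y] by simp
    then show "AE w in lborel \<Otimes>\<^sub>M lborel. norm (case w of (z, y) \<Rightarrow> g y * k (z + c * y) * h z) \<le>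
        norm (K * (case w of (z, y) \<Rightarrow> k (z + c * y) * h z))"
      by (intro AE_I2) (auto simp: abs_mult mult.assoc intro!: mult_right_mono)
  qed simp
qed

text \<open>Evenness of the kernel brings its argument into the form \<open>z + c * x\<close> in
  which \<open>integrable_product_conv\<close> and affine substitutions apply.\<close>

lemma kconv_alt: "kconv \<mu> h x = (\<integral>z. kexp \<mu> (z + (- 1) * x) * h z \<partial>lborel)"
  unfolding kconv_def
proof (rule Bochner_Integration.integral_cong)
  show "kexp \<mu> (x - z) * h z = kexp \<mu> (z + - 1 * x) * h z" for z
    using kexp_minus[of \<mu> "x - z"] by (simp del: kexp_minus)
qed simp

text \<open>Fubini for a bounded weight. The weight \<open>1\<close> yields integrability of the
  convolution; the weight \<open>kern x\<close> moves the second antiderivative from the convolution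
  to its kernel.\<close>

lemma kconv_integral:
  assumes \<mu>: "\<mu> > 0" and h: "integrable lborel h" and [measurable]: "g \<in> borel_measurable borel"
    and g: "\<And>y. \<bar>g y\<bar> \<le> K"
  shows "integrable lborel (\<lambda>y. g y * kconv \<mu> h y)"
    and "(\<integral>y. g y * kconv \<mu> h y \<partial>lborel) = (\<integral>z. (\<integral>y. g y * kexp \<mu> (y - z) \<partial>lborel) * h z \<partial>lborel)"
proof -
  have eq: "(\<lambda>y. g y * kconv \<mu> h y) = (\<lambda>y. \<integral>z. g y * kexp \<mu> (z + (- 1) * y) * h z \<partial>lborel)"
    by (simp add: kconv_alt mult.assoc)
  have i: "integrable (lborel \<Otimes>\<^sub>M lborel) (\<lambda>(z, y). g y * kexp \<mu> (z + (- 1) * y) * h z)"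
    by (rule integrable_product_conv[OF kexp_integrable[OF \<mu>] h _ g]) auto
  show "integrable lborel (\<lambda>y. g y * kconv \<mu> h y)"
    unfolding eq using lborel_pair.integrable_snd[OF i] by simp
  have s: "kexp \<mu> (z + - 1 * y) = kexp \<mu> (y - z)" for y z
    using kexp_minus[of \<mu> "y - z"] by (simp del: kexp_minus)
  show "(\<integral>y. g y * kconv \<mu> h y \<partial>lborel) = (\<integral>z. (\<integral>y. g y * kexp \<mu> (y - z) \<partial>lborel) * h z \<partial>lborel)"
    unfolding eq using lborel_pair.Fubini_integral[OF i] unfolding s by simp
qed

lemma kconv_integrable: "\<mu> > 0 \<Longrightarrow> integrable lborel h \<Longrightarrow> integrable lborel (kconv \<mu> h)"
  using kconv_integral(1)[of \<mu> h "\<lambda>_. 1" 1] by simp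

text \<open>\<open>nexp \<mu>\<close> is a \<open>C\<^sup>2\<close> second antiderivative of \<open>\<mu>\<^sup>2 kexp \<mu>\<close>: adding \<open>\<bar>v\<bar> / 2\<close> to the kernel
  removes its kink at the origin.\<close>

definition nexp :: "real \<Rightarrow> real \<Rightarrow> real" where
  "nexp \<mu> v = kexp \<mu> v + \<bar>v\<bar> / 2"

text \<open>On each half-line one of the two exponentials is constantly \<open>1\<close>. The
  \<open>min\<close> and \<open>max\<close> merge both branches into one visibly continuous
  formula.\<close>

definition nexp' :: "real \<Rightarrow> real \<Rightarrow> real" where
  "nexp' \<mu> v = (exp (\<mu> * min v 0) - exp (- \<mu> * max v 0)) / 2"

lemma nexp_deriv:
  assumes "v \<noteq> 0" "\<mu> > 0"
  shows "(nexp \<mu> has_real_derivative nexp' \<mu> v) (at v)"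
    and "(nexp' \<mu> has_real_derivative \<mu>\<^sup>2 * kexp \<mu> v) (at v)"
proof -
  consider "v > 0" | "v < 0" using assms(1) by linarith
  then have "(nexp \<mu> has_real_derivative nexp' \<mu> v) (at v) \<and>
      (nexp' \<mu> has_real_derivative \<mu>\<^sup>2 * kexp \<mu> v) (at v)"
  proof cases
    case 1
    have "((\<lambda>v. exp (- \<mu> * v) / (2 * \<mu>) + v / 2) has_real_derivative nexp' \<mu> v) (at v)"
      using assms 1 by (auto intro!: derivative_eq_intros simp: nexp'_def field_simps)
    moreover have "((\<lambda>v. (1 - exp (- \<mu> * v)) / 2) has_real_derivative \<mu>\<^sup>2 * kexp \<mu> v) (at v)"
      using assms 1 by (auto intro!: derivative_eq_intros simp: kexp_def field_simps power2_eq_square)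
    ultimately show ?thesis
      using 1 by (auto elim!: has_field_derivative_transform_within_open[where S = "{0<..}"]
          simp: nexp_def kexp_def nexp'_def)
  next
    case 2
    have "((\<lambda>v. exp (\<mu> * v) / (2 * \<mu>) - v / 2) has_real_derivative nexp' \<mu> v) (at v)"
      using assms 2 by (auto intro!: derivative_eq_intros simp: nexp'_def field_simps)
    moreover have "((\<lambda>v. (exp (\<mu> * v) - 1) / 2) has_real_derivative \<mu>\<^sup>2 * kexp \<mu> v) (at v)"
      using assms 2 by (auto intro!: derivative_eq_intros simp: kexp_def field_simps power2_eq_square)
    ultimately show ?thesis
      using 2 by (auto elim!: has_field_derivative_transform_within_open[where S = "{..<0}"]
          simp: nexp_def kexp_def nexp'_def)
  qed
  then show "(nexp \<mu> has_real_derivative nexp' \<mu> v) (at v)"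
    "(nexp' \<mu> has_real_derivative \<mu>\<^sup>2 * kexp \<mu> v) (at v)" by auto
qed

lemma continuous_nexp:
  "\<mu> > 0 \<Longrightarrow> continuous_on S (nexp \<mu>)" "continuous_on S (nexp' \<mu>)"
  unfolding nexp_def kexp_def nexp'_def by (auto intro!: continuous_intros)

lemma has_integral_set_LBINT:
  fixes f :: "real \<Rightarrow> real"
  assumes "set_integrable lborel S f"
  shows "(f has_integral (LBINT x:S. f x)) S"
  using set_borel_integral_eq_integral[OF assms] by (simp add: has_integral_integral)

text \<open>Taylor's formula with integral remainder: \<open>F\<close> has derivative
  \<open>(x - y) * n y\<close> in \<open>y\<close>. The finite set \<open>S\<close> accommodates
  functions given by different formulas on two half-lines.\<close>

lemma dbl_prim_second_deriv:
  fixes N N' n :: "real \<Rightarrow> real"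
  assumes S: "finite S" and cont: "continuous_on UNIV N" "continuous_on UNIV N'" "continuous_on UNIV n"
    and deriv: "\<And>y. y \<notin> S \<Longrightarrow> (N has_real_derivative N' y) (at y)"
      "\<And>y. y \<notin> S \<Longrightarrow> (N' has_real_derivative n y) (at y)"
  shows "dbl_prim n x = N x - N 0 - x * N' 0"
proof -
  define F where "F y = (x - y) * N' y + N y" for y
  have integral: "(LBINT y:{a..b}. (x - y) * n y) = F b - F a" if "a \<le> b" for a b
  proof -
    have "((\<lambda>y. (x - y) * n y) has_integral F b - F a) {a..b}"
    proof (rule fundamental_theorem_of_calculus_strong[OF S that])
      fix y assume "y \<in> {a..b} - S"
      then have y: "y \<notin> S" by simp
      show "(F has_vector_derivative (x - y) * n y) (at y)"
        unfolding F_def has_real_derivative_iff_has_vector_derivative[symmetric]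
        by (auto intro!: derivative_eq_intros deriv[OF y])
    next
      show "continuous_on {a..b} F"
        unfolding F_def by (intro continuous_intros continuous_on_subset[OF cont(1)] continuous_on_subset[OF cont(2)]) auto
    qed
    moreover have "set_integrable lborel {a..b} (\<lambda>y. (x - y) * n y)"
      by (intro borel_integrable_atLeastAtMost' continuous_intros continuous_on_subset[OF cont(3)]) auto
    then have "((\<lambda>y. (x - y) * n y) has_integral (LBINT y:{a..b}. (x - y) * n y)) {a..b}"
      by (rule has_integral_set_LBINT)
    ultimately show ?thesis
      by (rule has_integral_unique[rotated])
  qed
  have [measurable]: "n \<in> borel_measurable borel"
    by (rule borel_measurable_continuous_onI[OF cont(3)])
  show ?thesis
  proof (cases x "0 :: real" rule: linorder_cases)
    case less
    then show ?thesis
      using integral[of x 0] by (subst dbl_prim_neg) (simp_all add: F_def)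
  next
    case equal
    then show ?thesis by (simp add: dbl_prim_def)
  next
    case greater
    then show ?thesis
      using integral[of 0 x] by (subst dbl_prim_pos) (simp_all add: F_def)
  qed
qed

lemma dbl_prim_kexp:
  assumes \<mu>: "\<mu> > 0"
  shows "dbl_prim (\<lambda>y. \<mu>\<^sup>2 * kexp \<mu> (y - z)) x = nexp \<mu> (x - z) - nexp \<mu> (- z) - x * nexp' \<mu> (- z)"
proof -
  have "dbl_prim (\<lambda>y. \<mu>\<^sup>2 * kexp \<mu> (y - z)) x = nexp \<mu> (x - z) - nexp \<mu> (0 - z) - x * nexp' \<mu> (0 - z)"
  proof (rule dbl_prim_second_deriv[where S = "{z}" and N = "\<lambda>y. nexp \<mu> (y - z)" and N' = "\<lambda>y. nexp' \<mu> (y - z)"])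
    fix y assume "y \<notin> {z}"
    then have y: "y - z \<noteq> 0" by simp
    have "((\<lambda>y. nexp \<mu> (y - z)) has_real_derivative nexp' \<mu> (y - z) * 1) (at y)"
      by (rule DERIV_chain2[where g = "\<lambda>y. y - z", OF nexp_deriv(1)[OF y \<mu>]])
        (auto intro!: derivative_eq_intros)
    then show "((\<lambda>y. nexp \<mu> (y - z)) has_real_derivative nexp' \<mu> (y - z)) (at y)" by simp
    have "((\<lambda>y. nexp' \<mu> (y - z)) has_real_derivative \<mu>\<^sup>2 * kexp \<mu> (y - z) * 1) (at y)"
      by (rule DERIV_chain2[where g = "\<lambda>y. y - z", OF nexp_deriv(2)[OF y \<mu>]])
        (auto intro!: derivative_eq_intros)
    then show "((\<lambda>y. nexp' \<mu> (y - z)) has_real_derivative \<mu>\<^sup>2 * kexp \<mu> (y - z)) (at y)" by simp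
  next
    show "continuous_on UNIV (\<lambda>y. nexp \<mu> (y - z))"
      by (intro continuous_on_compose2[OF continuous_nexp(1)[OF \<mu>, of UNIV]] continuous_intros) auto
    show "continuous_on UNIV (\<lambda>y. nexp' \<mu> (y - z))"
      by (intro continuous_on_compose2[OF continuous_nexp(2)[of UNIV \<mu>]] continuous_intros) auto
    show "continuous_on UNIV (\<lambda>y. \<mu>\<^sup>2 * kexp \<mu> (y - z))"
      using \<mu> unfolding kexp_def by (intro continuous_intros) auto
  qed simp
  then show ?thesis by simp
qed

text \<open>After Fubini the second antiderivative acts on the kernel alone and gives
  \<open>nexp\<close> minus its Taylor polynomial. The absolute values in \<open>nexp\<close>
  produce \<open>kern x z\<close>, hence \<open>dbl_prim h\<close>; the exponentials give the
  convolution up to an affine function.\<close>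

lemma dbl_prim_kconv:
  assumes \<mu>: "\<mu> > 0" and h: "integrable lborel h"
  shows "\<exists>C D. \<forall>x. kconv \<mu> h x = C + D * x + dbl_prim (\<lambda>y. \<mu>\<^sup>2 * kconv \<mu> h y - h y) x"
proof -
  have [measurable]: "h \<in> borel_measurable borel"
    using borel_measurable_integrable[OF h] by simp
  \<comment> \<open>For \<open>z \<noteq> 0\<close> this is the derivative of
    \<open>kexp \<mu> (x - z)\<close> in \<open>x\<close> at \<open>x = 0\<close>. The value at
    \<open>z = 0\<close> follows the convention of \<open>kern\<close>, so that the identity
    \<open>N\<close> holds for every \<open>z\<close>.\<close>
  define d where "d z = (if z \<ge> 0 then exp (- \<mu> * \<bar>z\<bar>) else - exp (- \<mu> * \<bar>z\<bar>)) / 2" for z :: real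
  have [measurable]: "d \<in> borel_measurable borel"
    unfolding d_def by measurable
  have d: "\<bar>d z\<bar> \<le> 1" for z
    using \<mu> by (auto simp: d_def mult_nonneg_nonpos intro: order_trans[of _ 1])
  have di: "integrable lborel (\<lambda>z. d z * h z)"
    by (rule bounded_mult_integrable[OF h _ d]) simp
  have ki: "integrable lborel (\<lambda>z. kexp \<mu> (x - z) * h z)" for x
    by (rule bounded_mult_integrable[OF h _ kexp_le[OF \<mu>]]) simp
  have N: "nexp \<mu> (x - z) - nexp \<mu> (- z) - x * nexp' \<mu> (- z) =
      kexp \<mu> (x - z) - kexp \<mu> (- z) - x * d z + kern x z" for x z
    unfolding nexp_def kern_eq by (auto simp: nexp'_def d_def min_def max_def field_simps)
  have "kconv \<mu> h x = kconv \<mu> h 0 + (\<integral>z. d z * h z \<partial>lborel) * x + dbl_prim (\<lambda>y. \<mu>\<^sup>2 * kconv \<mu> h y - h y) x" for x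
  proof -
    have "dbl_prim (\<lambda>y. \<mu>\<^sup>2 * kconv \<mu> h y) x = \<mu>\<^sup>2 * (\<integral>y. kern x y * kconv \<mu> h y \<partial>lborel)"
      by (simp add: dbl_prim_scale) (simp add: dbl_prim_def)
    also have "(\<integral>y. kern x y * kconv \<mu> h y \<partial>lborel) = (\<integral>z. (\<integral>y. kern x y * kexp \<mu> (y - z) \<partial>lborel) * h z \<partial>lborel)"
      by (rule kconv_integral(2)[OF \<mu> h _ kern_le]) simp
    also have "\<mu>\<^sup>2 * \<dots> = (\<integral>z. dbl_prim (\<lambda>y. \<mu>\<^sup>2 * kexp \<mu> (y - z)) x * h z \<partial>lborel)"
      unfolding dbl_prim_scale by (simp add: mult.assoc dbl_prim_def)
    also have "\<dots> = (\<integral>z. kexp \<mu> (x - z) * h z - kexp \<mu> (0 - z) * h z - x * (d z * h z) + kern x z * h z \<partial>lborel)"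
      unfolding dbl_prim_kexp[OF \<mu>] N
      by (intro Bochner_Integration.integral_cong) (simp_all add: algebra_simps)
    also have "\<dots> = kconv \<mu> h x - kconv \<mu> h 0 - x * (\<integral>z. d z * h z \<partial>lborel) + dbl_prim h x"
      unfolding kconv_def dbl_prim_def
      using ki di kern_integrable[OF h] by (simp del: diff_0)
    finally have "dbl_prim (\<lambda>y. \<mu>\<^sup>2 * kconv \<mu> h y) x =
        kconv \<mu> h x - kconv \<mu> h 0 - x * (\<integral>z. d z * h z \<partial>lborel) + dbl_prim h x" .
    moreover have "dbl_prim (\<lambda>y. \<mu>\<^sup>2 * kconv \<mu> h y + (- 1) * h y) x =
        dbl_prim (\<lambda>y. \<mu>\<^sup>2 * kconv \<mu> h y) x + dbl_prim (\<lambda>y. (- 1) * h y) x"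
      using kconv_integrable[OF \<mu> h] h by (intro dbl_prim_add integrable_mult_right)
    moreover have "dbl_prim (\<lambda>y. (- 1) * h y) x = - dbl_prim h x"
      by (simp only: dbl_prim_scale)
    ultimately show ?thesis by simp
  qed
  then show ?thesis by blast
qed

lemma Delta_rel_kconv:
  assumes \<mu>: "\<mu> > 0" and h: "integrable lborel h"
  shows "Delta_rel 1 1 (abs_L1 (kconv \<mu> h)) (\<mu>\<^sup>2 *\<^sub>R abs_L1 (kconv \<mu> h) - abs_L1 h)"
proof -
  let ?g = "\<lambda>y. \<mu>\<^sup>2 * kconv \<mu> h y - h y"
  note u = kconv_integrable[OF \<mu> h]
  have g: "integrable lborel ?g" using u h by simp
  have "Delta_rel_fun 1 1 (kconv \<mu> h) ?g"
    using dbl_prim_kconv[OF \<mu> h] borel_measurable_integrable[OF g]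
    by (subst Delta_rel_fun_iff) auto
  then have "Delta_rel 1 1 (abs_L1 (kconv \<mu> h)) (abs_L1 ?g)"
    using u g by (simp add: L1_rel_refl Delta_rel.abs_eq)
  also have "abs_L1 ?g = \<mu>\<^sup>2 *\<^sub>R abs_L1 (kconv \<mu> h) - abs_L1 h"
    using u h by (simp add: L1_rel_refl minus_L1.abs_eq scaleR_L1.abs_eq)
  finally show ?thesis .
qed

section \<open>The Laplace transform of the translation family\<close>

text \<open>
  Pairing with bounded functions reduces the identification of the \<^typ>\<open>L1\<close>-valued Laplace
  integral to the scalar Fubini theorem.
\<close>

definition pairing :: "(real \<Rightarrow> real) \<Rightarrow> L1 \<Rightarrow> real" where
  "pairing g \<phi> = (\<integral>x. g x * rep_L1 \<phi> x \<partial>lborel)"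

lemma pairing_abs_L1:
  assumes "integrable lborel f" and [measurable]: "g \<in> borel_measurable borel"
  shows "pairing g (abs_L1 f) = (\<integral>x. g x * f x \<partial>lborel)"
  unfolding pairing_def
proof (rule integral_cong_AE)
  note [measurable] = borel_measurable_integrable[OF assms(1), simplified]
    borel_measurable_integrable[OF integrable_rep_L1[of "abs_L1 f"], simplified]
  show "(\<lambda>x. g x * rep_L1 (abs_L1 f) x) \<in> borel_measurable lborel"
    "(\<lambda>x. g x * f x) \<in> borel_measurable lborel" by measurable
  show "AE x in lborel. g x * rep_L1 (abs_L1 f) x = g x * f x"
    using rep_abs_L1[OF assms(1)] by eventually_elim simp
qed

lemma bounded_linear_pairing:
  assumes g[measurable]: "g \<in> borel_measurable borel" and K: "\<And>x. \<bar>g x\<bar> \<le> K"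
  shows "bounded_linear (pairing g)"
proof (rule bounded_linear_intro[where K = K])
  fix \<phi> \<psi> :: L1 and c :: real
  let ?f = "rep_L1 \<phi>" and ?h = "rep_L1 \<psi>"
  note i = integrable_rep_L1 bounded_mult_integrable[OF integrable_rep_L1 g K]
  have "\<phi> + \<psi> = abs_L1 (\<lambda>x. ?f x + ?h x)"
    using plus_L1.abs_eq[OF L1_rel_refl L1_rel_refl, of ?f ?h] i by simp
  then show "pairing g (\<phi> + \<psi>) = pairing g \<phi> + pairing g \<psi>"
    using i by (simp add: pairing_abs_L1 distrib_left) (simp add: pairing_def)
  have "c *\<^sub>R \<phi> = abs_L1 (\<lambda>x. c * ?f x)"
    using scaleR_L1.abs_eq[OF L1_rel_refl, of ?f c] i by simp
  then show "pairing g (c *\<^sub>R \<phi>) = c *\<^sub>R pairing g \<phi>"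
    using i by (simp add: pairing_abs_L1 mult.left_commute) (simp add: pairing_def)
  have "norm (pairing g \<phi>) \<le> (\<integral>x. \<bar>g x * ?f x\<bar> \<partial>lborel)"
    unfolding pairing_def real_norm_def by (rule integral_abs_bound)
  also have "\<dots> \<le> (\<integral>x. K * \<bar>?f x\<bar> \<partial>lborel)"
    using i by (intro integral_mono integrable_abs integrable_mult_right) (auto simp: abs_mult intro!: mult_right_mono K)
  also have "\<dots> = norm \<phi> * K"
    by (simp add: norm_L1_eq)
  finally show "norm (pairing g \<phi>) \<le> norm \<phi> * K" .
qed

text \<open>The sign of a representative of the difference is an admissible test function, and
  pairing the difference with it returns its norm.\<close>

lemma L1_eqI:
  assumes "\<And>g. g \<in> borel_measurable borel \<Longrightarrow> (\<And>x. \<bar>g x\<bar> \<le> 1) \<Longrightarrow> pairing g \<phi> = pairing g \<psi>"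
  shows "\<phi> = \<psi>"
proof -
  define g where "g x = sgn (rep_L1 (\<phi> - \<psi>) x)" for x
  have [measurable]: "rep_L1 (\<phi> - \<psi>) \<in> borel_measurable borel"
    using borel_measurable_integrable[OF integrable_rep_L1] by simp
  have g: "g \<in> borel_measurable borel" "\<And>x. \<bar>g x\<bar> \<le> 1"
    unfolding g_def by (auto simp: sgn_if)
  have "norm (\<phi> - \<psi>) = pairing g (\<phi> - \<psi>)"
    unfolding norm_L1_eq pairing_def g_def by (simp add: sgn_mult_self_eq mult.commute flip: abs_sgn)
  also have "\<dots> = pairing g \<phi> - pairing g \<psi>"
    by (rule linear_diff[OF bounded_linear.linear[OF bounded_linear_pairing[OF g]]])
  also have "\<dots> = 0" using assms[OF g] by simp
  finally show ?thesis by simp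
qed

text \<open>Unfolding the half-line: the summand \<open>v (- t)\<close> is carried to the negative
  axis, and the two halves of the weight join to \<open>exp (- \<mu> * \<bar>t\<bar>) / 2\<close>,
  which is \<open>\<mu> * kexp \<mu> t\<close>.\<close>

lemma laplace_even_part:
  fixes v :: "real \<Rightarrow> real"
  assumes \<mu>: "\<mu> > 0" and cont: "continuous_on UNIV v" and K: "\<And>t. \<bar>v t\<bar> \<le> K"
  shows "((\<lambda>t. exp (- \<mu> * t) * ((v t + v (- t)) / 2)) has_integral \<mu> * (\<integral>t. kexp \<mu> t * v t \<partial>lborel)) {0..}"
proof -
  have v[measurable]: "v \<in> borel_measurable borel"
    by (rule borel_measurable_continuous_onI[OF cont])
  define w where "w t = indicator {0..} t * exp (- \<mu> * t)" for t :: real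
  have w: "integrable lborel w"
  proof (rule Bochner_Integration.integrable_bound[OF integrable_exp_abs[OF \<mu>]])
    show "w \<in> borel_measurable lborel" unfolding w_def by measurable
    show "AE t in lborel. norm (w t) \<le> norm (exp (- \<mu> * \<bar>t\<bar>))"
      by (auto simp: w_def indicator_def)
  qed
  have r: "integrable lborel (\<lambda>t. v t * w t)"
    by (rule bounded_mult_integrable[OF w v K])
  have l: "integrable lborel (\<lambda>t. v (- t) * w t)"
    by (rule bounded_mult_integrable[OF w _ K]) simp
  have l': "integrable lborel (\<lambda>t. v t * w (- t))"
    using integrable_uminus_arg[OF l] by simp
  have flip: "(\<integral>t. v (- t) * w t \<partial>lborel) = (\<integral>t. v t * w (- t) \<partial>lborel)"
    by (subst lborel_integral_real_affine[of "-1" _ 0]) simp_all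
  have eq: "(\<lambda>t. indicator {0..} t *\<^sub>R (exp (- \<mu> * t) * ((v t + v (- t)) / 2))) =
      (\<lambda>t. (v t * w t + v (- t) * w t) / 2)"
    by (simp add: w_def fun_eq_iff algebra_simps add_divide_distrib)
  have "set_integrable lborel {0..} (\<lambda>t. exp (- \<mu> * t) * ((v t + v (- t)) / 2))"
    unfolding set_integrable_def eq using r l by simp
  then have "((\<lambda>t. exp (- \<mu> * t) * ((v t + v (- t)) / 2)) has_integral
      (LBINT t:{0..}. exp (- \<mu> * t) * ((v t + v (- t)) / 2))) {0..}"
    by (rule has_integral_set_LBINT)
  also have "(LBINT t:{0..}. exp (- \<mu> * t) * ((v t + v (- t)) / 2)) =
      ((\<integral>t. v t * w t \<partial>lborel) + (\<integral>t. v t * w (- t) \<partial>lborel)) / 2"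
    unfolding set_lebesgue_integral_def eq using r l by (simp add: flip)
  also have "\<dots> = (\<integral>t. (v t * w t + v t * w (- t)) / 2 \<partial>lborel)"
    using r l' by simp
  also have "\<dots> = (\<integral>t. \<mu> * (kexp \<mu> t * v t) \<partial>lborel)"
  proof (rule integral_cong_AE)
    \<comment> \<open>At \<open>t = 0\<close> both \<open>w t\<close> and \<open>w (- t)\<close> are
      \<open>1\<close>, so the two sides may differ there.\<close>
    show "AE t in lborel. (v t * w t + v t * w (- t)) / 2 = \<mu> * (kexp \<mu> t * v t)"
      using AE_lborel_singleton[of 0]
      by eventually_elim (use \<mu> in \<open>auto simp: w_def kexp_def indicator_def abs_if\<close>)
  qed (simp_all add: w_def)
  also have "\<dots> = \<mu> * (\<integral>t. kexp \<mu> t * v t \<partial>lborel)" by simp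
  finally show ?thesis .
qed

text \<open>Fubini turns the \<open>kexp\<close>-weighted average of the translates of
  \<open>h\<close> into the convolution; the substitution in the inner integral is a
  translation.\<close>

lemma integral_kexp_pairing_shift:
  assumes \<mu>: "\<mu> > 0" and h: "integrable lborel h" and g[measurable]: "g \<in> borel_measurable borel"
    and K: "\<And>x. \<bar>g x\<bar> \<le> K"
  shows "(\<integral>t. kexp \<mu> t * pairing g (shift t (abs_L1 h)) \<partial>lborel) = pairing g (abs_L1 (kconv \<mu> h))"
proof -
  have i: "integrable (lborel \<Otimes>\<^sub>M lborel) (\<lambda>(t, x). g x * h (t + 1 * x) * kexp \<mu> t)"
    by (rule integrable_product_conv[OF h kexp_integrable[OF \<mu>] g K]) simp
  have "(\<integral>t. kexp \<mu> t * pairing g (shift t (abs_L1 h)) \<partial>lborel) =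
      (\<integral>t. (\<integral>x. g x * h (t + 1 * x) * kexp \<mu> t \<partial>lborel) \<partial>lborel)"
    by (simp add: shift_abs_L1 h pairing_abs_L1 integrable_shift shift_fun_def add.commute mult.commute)
  also have "\<dots> = (\<integral>x. (\<integral>t. g x * h (t + 1 * x) * kexp \<mu> t \<partial>lborel) \<partial>lborel)"
    using lborel_pair.Fubini_integral[OF i] by simp
  also have "\<dots> = (\<integral>x. g x * kconv \<mu> h x \<partial>lborel)"
  proof (rule Bochner_Integration.integral_cong)
    fix x
    have "(\<lambda>t. g x * h (t + 1 * x) * kexp \<mu> t) = (\<lambda>t. g x * (kexp \<mu> t * h (x + 1 * t)))"
      by (simp add: fun_eq_iff add.commute)
    then have "(\<integral>t. g x * h (t + 1 * x) * kexp \<mu> t \<partial>lborel) = g x * (\<integral>t. kexp \<mu> t * h (x + 1 * t) \<partial>lborel)"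
      by (simp only: integral_mult_right_zero)
    also have "(\<integral>t. kexp \<mu> t * h (x + 1 * t) \<partial>lborel) = kconv \<mu> h x"
      unfolding kconv_alt by (subst (2) lborel_integral_real_affine[of 1 _ x]) simp_all
    finally show "(\<integral>t. g x * h (t + 1 * x) * kexp \<mu> t \<partial>lborel) = g x * kconv \<mu> h x" .
  qed simp
  also have "\<dots> = pairing g (abs_L1 (kconv \<mu> h))"
    by (simp add: pairing_abs_L1 kconv_integrable \<mu> h)
  finally show ?thesis .
qed

text \<open>The family \<open>G(t)\<close>, which is d'Alembert's solution of the wave equation with
  zero initial velocity.\<close>

definition wave :: "real \<Rightarrow> L1 \<Rightarrow> L1" where
  "wave t \<phi> = (1/2) *\<^sub>R (shift t \<phi> + shift (- t) \<phi>)"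

lemma wave_0: "wave 0 \<phi> = \<phi>"
  by (simp add: wave_def shift_zero flip: scaleR_2)

lemma continuous_wave: "continuous_on UNIV (\<lambda>t. wave t \<phi>)"
  unfolding wave_def
  by (intro continuous_intros continuous_shift continuous_on_compose2[OF continuous_shift]) auto

lemma norm_wave_le: "norm (wave t \<phi>) \<le> norm \<phi>"
  using norm_triangle_ineq[of "shift t \<phi>" "shift (- t) \<phi>"] by (simp add: wave_def norm_shift)

lemma bounded_linear_wave: "bounded_linear (wave t)"
  unfolding wave_def
  by (intro bounded_linear_const_scaleR bounded_linear_add bounded_linear_shift)

lemma wave_cosine_eq: "2 *\<^sub>R wave t (wave s \<phi>) = wave (t + s) \<phi> + wave (t - s) \<phi>"
  by (simp add: wave_def shift_add shift_scale shift_shift scaleR_add_right add.commute algebra_simps)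

text \<open>A bounded functional may be moved inside the vector-valued integral only once that
  integral exists. Each pairing then becomes a scalar Laplace transform of an even part.\<close>

lemma wave_laplace:
  assumes \<mu>: "\<mu> > 0"
  shows "((\<lambda>t. exp (- \<mu> * t) *\<^sub>R wave t \<phi>) has_integral \<mu> *\<^sub>R abs_L1 (kconv \<mu> (rep_L1 \<phi>))) {0..}"
proof -
  let ?u = "abs_L1 (kconv \<mu> (rep_L1 \<phi>))"
  obtain I where I: "((\<lambda>t. exp (- \<mu> * t) *\<^sub>R wave t \<phi>) has_integral I) {0..}"
    using laplace_integrable[OF \<mu> continuous_wave norm_wave_le] unfolding integrable_on_def by blast
  have "I = \<mu> *\<^sub>R ?u"
  proof (rule L1_eqI)
    fix g :: "real \<Rightarrow> real" assume g: "g \<in> borel_measurable borel" "\<And>x. \<bar>g x\<bar> \<le> 1"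
    interpret P: bounded_linear "pairing g" by (rule bounded_linear_pairing[OF g])
    define v where "v t = pairing g (shift t \<phi>)" for t
    have v_cont: "continuous_on UNIV v"
      unfolding v_def by (rule P.continuous_on[OF continuous_shift])
    obtain K where "\<And>\<psi>. norm (pairing g \<psi>) \<le> norm \<psi> * K"
      using P.bounded by blast
    then have v_bound: "\<bar>v t\<bar> \<le> norm \<phi> * K" for t
      unfolding v_def by (metis norm_shift real_norm_def)
    have "((\<lambda>t. exp (- \<mu> * t) * ((v t + v (- t)) / 2)) has_integral pairing g I) {0..}"
      using has_integral_linear[OF I P.bounded_linear_axioms]
      by (simp add: o_def P.scaleR wave_def P.add v_def)
    then have "pairing g I = \<mu> * (\<integral>t. kexp \<mu> t * v t \<partial>lborel)"
      by (rule has_integral_unique[OF _ laplace_even_part[OF \<mu> v_cont v_bound]])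
    also have "\<dots> = pairing g (\<mu> *\<^sub>R ?u)"
      using integral_kexp_pairing_shift[OF \<mu> integrable_rep_L1[of \<phi>] g] by (simp add: v_def P.scaleR)
    finally show "pairing g I = pairing g (\<mu> *\<^sub>R ?u)" .
  qed
  with I show ?thesis by simp
qed

section \<open>Absence of integrable eigenfunctions of the second derivative\<close>

text \<open>Factorisation of the operator: \<open>F' + \<mu> F\<close> and
  \<open>\<mu> F - F'\<close> satisfy first-order equations, become constant after multiplication by
  an integrating factor, and add up to \<open>2 * \<mu> * F\<close>.\<close>

lemma exponential_ode:
  fixes F :: "real \<Rightarrow> real"
  assumes \<mu>: "\<mu> > 0" and F: "\<And>x. (F has_real_derivative F' x) (at x)"
    and F': "\<And>x. (F' has_real_derivative \<mu>\<^sup>2 * F x) (at x)"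
  obtains A B where "\<And>x. F x = A * exp (\<mu> * x) + B * exp (- \<mu> * x)"
proof -
  have "((\<lambda>x. (F' x + \<mu> * F x) * exp (- \<mu> * x)) has_real_derivative 0) (at x)" for x
    by (auto intro!: derivative_eq_intros F F' simp: algebra_simps power2_eq_square)
  then have A: "(F' x + \<mu> * F x) * exp (- \<mu> * x) = F' 0 + \<mu> * F 0" for x
    using DERIV_isconst_all[of "\<lambda>x. (F' x + \<mu> * F x) * exp (- \<mu> * x)" x 0] by simp
  have "((\<lambda>x. (\<mu> * F x - F' x) * exp (\<mu> * x)) has_real_derivative 0) (at x)" for x
    by (auto intro!: derivative_eq_intros F F' simp: algebra_simps power2_eq_square)
  then have B: "(\<mu> * F x - F' x) * exp (\<mu> * x) = \<mu> * F 0 - F' 0" for x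
    using DERIV_isconst_all[of "\<lambda>x. (\<mu> * F x - F' x) * exp (\<mu> * x)" x 0] by simp
  show thesis
  proof
    fix x
    have "F' x + \<mu> * F x = (F' 0 + \<mu> * F 0) * exp (\<mu> * x)"
      unfolding A[of x, symmetric] by (simp add: mult.assoc flip: exp_add)
    moreover have "\<mu> * F x - F' x = (\<mu> * F 0 - F' 0) * exp (- \<mu> * x)"
      unfolding B[of x, symmetric] by (simp add: mult.assoc flip: exp_add)
    ultimately have "2 * \<mu> * F x = (F' 0 + \<mu> * F 0) * exp (\<mu> * x) + (\<mu> * F 0 - F' 0) * exp (- \<mu> * x)"
      by linarith
    then have "F x = ((F' 0 + \<mu> * F 0) * exp (\<mu> * x) + (\<mu> * F 0 - F' 0) * exp (- \<mu> * x)) / (2 * \<mu>)"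
      using \<mu> by (subst nonzero_eq_divide_eq) (simp_all add: mult.commute)
    then show "F x = (F' 0 + \<mu> * F 0) / (2 * \<mu>) * exp (\<mu> * x) + (\<mu> * F 0 - F' 0) / (2 * \<mu>) * exp (- \<mu> * x)"
      by (simp only: add_divide_distrib[of "(F' 0 + _) * _"] times_divide_eq_left)
  qed
qed

text \<open>
  \<open>f(x + 1) + f(x - 1) = 2 cosh \<mu> f(x)\<close>, whereas translations are isometric and \<open>cosh \<mu> > 1\<close>.
\<close>

lemma integrable_exponential_eq_0:
  assumes \<mu>: "\<mu> > 0" and f: "integrable lborel f"
    and F: "\<And>x. f x = A * exp (\<mu> * x) + B * exp (- \<mu> * x)"
  shows "abs_L1 f = 0"
proof -
  let ?c = "exp \<mu> + exp (- \<mu>)"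
  have "shift_fun 1 f x + shift_fun (- 1) f x = ?c * f x" for x
    by (simp add: shift_fun_def F algebra_simps flip: exp_add)
  then have "shift 1 (abs_L1 f) + shift (- 1) (abs_L1 f) = ?c *\<^sub>R abs_L1 f"
    using f integrable_shift[OF f]
    by (simp add: shift_abs_L1 plus_L1.abs_eq scaleR_L1.abs_eq L1_rel_refl)
  then have "norm (?c *\<^sub>R abs_L1 f) \<le> norm (abs_L1 f) + norm (abs_L1 f)"
    by (metis norm_triangle_ineq norm_shift)
  moreover have "norm (?c *\<^sub>R abs_L1 f) = ?c * norm (abs_L1 f)"
    unfolding norm_scaleR by (simp add: add_pos_pos)
  ultimately have "(?c - 2) * norm (abs_L1 f) \<le> 0"
    by (simp add: algebra_simps)
  \<comment> \<open>Linear lower bounds for both exponentials would give only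
    \<open>?c \<ge> 2\<close>; the quadratic term makes the inequality strict.\<close>
  moreover have "1 + \<mu> + \<mu>\<^sup>2 / 2 \<le> exp \<mu>" "1 + - \<mu> \<le> exp (- \<mu>)"
    using \<mu> exp_lower_Taylor_quadratic[of \<mu>] exp_ge_add_one_self[of "- \<mu>"] by auto
  then have "?c - 2 > 0" using \<mu> zero_less_power[OF \<mu>, of 2] by linarith
  ultimately have "norm (abs_L1 f) \<le> 0"
    by (simp add: mult_le_0_iff)
  then show ?thesis by simp
qed

text \<open>Regularity bootstrap: the integral representation gives a continuous version
  \<open>F\<close> of the eigenfunction. By Taylor's formula \<open>F\<close> is then an affine
  function plus \<open>\<mu>\<^sup>2\<close> times a second antiderivative of itself, so it is a
  classical solution and a sum of exponentials.\<close>

lemma Delta_rel_eigen_eq_0: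
  assumes \<mu>: "\<mu> > 0" and rel: "Delta_rel 1 1 \<phi> (\<mu>\<^sup>2 *\<^sub>R \<phi>)"
  shows "\<phi> = 0"
proof -
  define f where "f = rep_L1 \<phi>"
  have f: "integrable lborel f" and \<phi>: "\<phi> = abs_L1 f"
    by (simp_all add: f_def integrable_rep_L1)
  have "Delta_rel_fun 1 1 f (\<lambda>x. \<mu>\<^sup>2 * f x)"
    using rel f unfolding \<phi> by (simp add: scaleR_L1.abs_eq Delta_rel.abs_eq L1_rel_refl)
  then obtain C D where fF: "AE x in lborel. f x = C + D * x + \<mu>\<^sup>2 * dbl_prim f x"
    using borel_measurable_integrable[OF f] by (subst (asm) Delta_rel_fun_iff) (auto simp: dbl_prim_scale)
  define F where "F x = C + D * x + \<mu>\<^sup>2 * dbl_prim f x" for x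
  have F_cont: "continuous_on UNIV F"
    unfolding F_def by (intro continuous_intros continuous_dbl_prim f)
  have AE: "AE x in lborel. f x = F x"
    using fF by (simp add: F_def)
  have F_int: "integrable lborel F"
    using f borel_measurable_continuous_onI[OF F_cont] AE by (rule_tac integrable_cong_AE_imp) auto
  have "isCont F x" for x
    using F_cont by (simp add: continuous_on_eq_continuous_at)
  then obtain G where G: "\<And>x. (G has_vector_derivative F x) (at x)"
    using einterval_antiderivative[of "-\<infinity>" \<infinity> F] by auto
  then have "isCont G x" for x
    using has_vector_derivative_continuous by blast
  then obtain H where H: "\<And>x. (H has_vector_derivative G x) (at x)"
    using einterval_antiderivative[of "-\<infinity>" \<infinity> G] by auto
  note G' = G[folded has_real_derivative_iff_has_vector_derivative]
  note H' = H[folded has_real_derivative_iff_has_vector_derivative]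
  have "dbl_prim f x = dbl_prim F x" for x
    by (rule dbl_prim_cong_AE[OF AE f F_int])
  also have "dbl_prim F x = H x - H 0 - x * G 0" for x
    by (rule dbl_prim_second_deriv[where S = "{}"])
      (auto intro!: F_cont G' H' DERIV_continuous_on[OF DERIV_subset[OF G']] DERIV_continuous_on[OF DERIV_subset[OF H']])
  finally have F_eq: "F x = C + D * x + \<mu>\<^sup>2 * (H x - H 0 - x * G 0)" for x
    by (simp add: F_def)
  have F1: "(F has_real_derivative D + \<mu>\<^sup>2 * (G x - G 0)) (at x)" for x
    unfolding F_eq[abs_def] by (auto intro!: derivative_eq_intros H')
  have F2: "((\<lambda>x. D + \<mu>\<^sup>2 * (G x - G 0)) has_real_derivative \<mu>\<^sup>2 * F x) (at x)" for x
    by (auto intro!: derivative_eq_intros G')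
  obtain A B where "\<And>x. F x = A * exp (\<mu> * x) + B * exp (- \<mu> * x)"
    using exponential_ode[OF \<mu> F1 F2] by blast
  then have "abs_L1 F = 0"
    by (rule integrable_exponential_eq_0[OF \<mu> F_int])
  then show ?thesis
    using AE abs_L1_eq_iff[OF f F_int] \<phi> by simp
qed

section \<open>Linearity of the relation and transfer to general \<open>p\<close> and
  \<open>q\<close>\<close>

lemma Delta_rel_fun_combine:
  assumes "integrable lborel g" "integrable lborel g'"
    and "Delta_rel_fun p q f g" "Delta_rel_fun p q f' g'"
  shows "Delta_rel_fun p q (\<lambda>x. f x + c * f' x) (\<lambda>x. g x + c * g' x)"
proof -
  note m = borel_measurable_integrable[OF assms(1), simplified] borel_measurable_integrable[OF assms(2), simplified]
  obtain C D where 1: "AE x in lborel. f x = (if x < 0 then q else p) * C + D * x + dbl_prim g x"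
    using assms(3) Delta_rel_fun_iff[OF m(1)] by blast
  obtain C' D' where 2: "AE x in lborel. f' x = (if x < 0 then q else p) * C' + D' * x + dbl_prim g' x"
    using assms(4) Delta_rel_fun_iff[OF m(2)] by blast
  have "AE x in lborel. f x + c * f' x = (if x < 0 then q else p) * (C + c * C') + (D + c * D') * x +
      dbl_prim (\<lambda>x. g x + c * g' x) x"
    using 1 2
  proof eventually_elim
    case (elim x)
    then show ?case
      using assms(1,2) by (simp add: dbl_prim_add dbl_prim_scale algebra_simps split del: if_split)
  qed
  moreover have "(\<lambda>x. g x + c * g' x) \<in> borel_measurable borel"
    using m by simp
  ultimately show ?thesis
    using Delta_rel_fun_iff by blast
qed

text \<open>One statement covers both closure properties: \<open>c = 1\<close> gives sums, and
  taking \<open>0\<close> for \<open>\<phi>\<close> and \<open>\<psi>\<close> gives scalar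
  multiples.\<close>

lemma Delta_rel_combine:
  "Delta_rel p q \<phi> \<psi> \<Longrightarrow> Delta_rel p q \<phi>' \<psi>' \<Longrightarrow> Delta_rel p q (\<phi> + c *\<^sub>R \<phi>') (\<psi> + c *\<^sub>R \<psi>')"
proof (transfer fixing: p q c)
  fix f g f' g' assume "L1_rel g g" "L1_rel g' g'" "Delta_rel_fun p q f g" "Delta_rel_fun p q f' g'"
  then show "Delta_rel_fun p q (\<lambda>x. f x + c * f' x) (\<lambda>x. g x + c * g' x)"
    by (intro Delta_rel_fun_combine) (simp_all add: L1_rel_def)
qed

lemma Delta_rel_zero: "Delta_rel p q 0 0"
proof (transfer fixing: p q)
  show "Delta_rel_fun p q (\<lambda>_. 0) (\<lambda>_. 0)"
    by (subst Delta_rel_fun_iff) (auto intro!: exI[of _ 0] simp: dbl_prim_def)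
qed

theorem proposition6p1:
  fixes p q :: real
  assumes "p \<ge> 0" and "q \<ge> 0" and "p + q > 0"
  shows "strongly_continuous_cosine_family (Cpq p q) \<and>
         is_cosine_generator (Cpq p q) (Delta_dom p q) (Delta p q)"
proof -
  define b where "b = (q - p) / (p + q)"
  have pq: "p + q \<noteq> 0" using assms(3) by simp
  \<comment> \<open>The scaling \<open>c\<close> is the common boundary value
    \<open>(p + q) / 2\<close> on the way to the pair \<open>(1, 1)\<close>, and its reciprocal on
    the way back.\<close>
  have to_11: "1 * ((p + q) / 2) = p + b * (p + q) / 2" "1 * ((p + q) / 2) = q - b * (p + q) / 2"
    and from_11: "p * (2 / (p + q)) = 1 + (- b) * (1 + 1) / 2" "q * (2 / (p + q)) = 1 - (- b) * (1 + 1) / 2"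
    using pq by (simp_all add: b_def field_simps)
  have C: "Cpq p q t \<phi> = twist (- b) (wave t (twist b \<phi>))" for t \<phi>
    unfolding wave_def by (rule Cpq_eq[OF pq b_def])
  interpret T: bounded_linear "twist b" by (rule bounded_linear_twist)
  interpret V: bounded_linear "twist (- b)" by (rule bounded_linear_twist)
  have TV: "twist b (twist (- b) \<phi>) = \<phi>" for \<phi>
    using twist_inverse[of "- b"] by simp
  have family: "strongly_continuous_cosine_family (Cpq p q)"
    unfolding strongly_continuous_cosine_family_def C[abs_def]
  proof (intro conjI allI)
    show "bounded_linear (\<lambda>\<phi>. twist (- b) (wave t (twist b \<phi>)))" for t
      by (intro bounded_linear_compose[OF bounded_linear_twist] bounded_linear_compose[OF bounded_linear_wave]
          bounded_linear_twist)
    show "continuous_on UNIV (\<lambda>t. twist (- b) (wave t (twist b \<phi>)))" for \<phi>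
      by (rule V.continuous_on[OF continuous_wave])
    show "twist (- b) (wave 0 (twist b \<phi>)) = \<phi>" for \<phi>
      by (simp add: wave_0 twist_inverse)
    show "2 *\<^sub>R twist (- b) (wave t (twist b (twist (- b) (wave s (twist b \<phi>))))) =
        twist (- b) (wave (t + s) (twist b \<phi>)) + twist (- b) (wave (t - s) (twist b \<phi>))" for s t \<phi>
      unfolding TV by (simp only: wave_cosine_eq flip: V.scaleR V.add)
  qed
  obtain K where K: "K \<ge> 0" "\<And>\<phi>. norm (twist (- b) \<phi>) \<le> norm \<phi> * K"
    using V.nonneg_bounded by blast
  obtain K' where K': "\<And>\<phi>. norm (twist b \<phi>) \<le> norm \<phi> * K'"
    using T.bounded by blast
  \<comment> \<open>The bound is uniform in \<open>t\<close> because \<open>wave t\<close> is a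
    contraction and neither twist depends on \<open>t\<close>.\<close>
  have "norm (Cpq p q t \<phi>) \<le> (K' * K) * norm \<phi>" for t \<phi>
  proof -
    have "norm (Cpq p q t \<phi>) \<le> norm (wave t (twist b \<phi>)) * K"
      unfolding C by (rule K(2))
    also have "\<dots> \<le> norm (twist b \<phi>) * K"
      by (intro mult_right_mono norm_wave_le K(1))
    also have "\<dots> \<le> norm \<phi> * K' * K"
      by (intro mult_right_mono K' K(1))
    finally show ?thesis by (simp add: mult_ac)
  qed
  then have bounded: "bounded_cosine_family (Cpq p q)"
    using family unfolding bounded_cosine_family_def by blast
  have "is_cosine_generator (Cpq p q) {\<phi>. \<exists>\<psi>. Delta_rel p q \<phi> \<psi>} (\<lambda>\<phi>. THE \<psi>. Delta_rel p q \<phi> \<psi>)"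
  proof (rule cosine_generatorI[OF bounded])
    show "Delta_rel p q (\<phi> + \<phi>') (\<psi> + \<psi>')" if "Delta_rel p q \<phi> \<psi>" "Delta_rel p q \<phi>' \<psi>'" for \<phi> \<psi> \<phi>' \<psi>'
      using Delta_rel_combine[OF that, of 1] by simp
    show "Delta_rel p q (c *\<^sub>R \<phi>) (c *\<^sub>R \<psi>)" if "Delta_rel p q \<phi> \<psi>" for c \<phi> \<psi>
      using Delta_rel_combine[OF Delta_rel_zero that, of c] by simp
  next
    fix \<mu> :: real and \<phi>
    assume \<mu>: "\<mu> > 0" and "Delta_rel p q \<phi> (\<mu>\<^sup>2 *\<^sub>R \<phi>)"
    then have "Delta_rel 1 1 (twist b \<phi>) (\<mu>\<^sup>2 *\<^sub>R twist b \<phi>)"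
      using Delta_rel_twist[OF to_11] by (metis T.scaleR)
    then have "twist b \<phi> = 0" by (rule Delta_rel_eigen_eq_0[OF \<mu>])
    then show "\<phi> = 0" using twist_inverse[of b \<phi>] V.zero by simp
  next
    fix \<mu> :: real and h
    assume \<mu>: "\<mu> > 0"
    define u where "u = abs_L1 (kconv \<mu> (rep_L1 (twist b h)))"
    have "Delta_rel 1 1 u (\<mu>\<^sup>2 *\<^sub>R u - twist b h)"
      unfolding u_def using Delta_rel_kconv[OF \<mu> integrable_rep_L1[of "twist b h"]] by simp
    then have "Delta_rel p q (twist (- b) u) (twist (- b) (\<mu>\<^sup>2 *\<^sub>R u - twist b h))"
      by (rule Delta_rel_twist[OF from_11])
    then have "Delta_rel p q (twist (- b) u) (\<mu>\<^sup>2 *\<^sub>R twist (- b) u - h)"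
      by (simp add: V.diff V.scaleR twist_inverse)
    moreover have "((\<lambda>t. exp (- \<mu> * t) *\<^sub>R Cpq p q t h) has_integral \<mu> *\<^sub>R twist (- b) u) {0..}"
      using has_integral_linear[OF wave_laplace[OF \<mu>, of "twist b h"] V.bounded_linear_axioms]
      by (simp add: o_def V.scaleR C u_def)
    ultimately show "\<exists>u. Delta_rel p q u (\<mu>\<^sup>2 *\<^sub>R u - h) \<and>
        ((\<lambda>t. exp (- \<mu> * t) *\<^sub>R Cpq p q t h) has_integral \<mu> *\<^sub>R u) {0..}" by blast
  qed
  with family show ?thesis
    unfolding Delta_dom_def Delta_def[abs_def] by blast
qed

end
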